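(* Let $1<k<2$, with notation as in the context. For every $x\in(-1,x_0]$, the equations $$R(x)-L(x)=2(x+1),\qquad A(R(x))-A(L(x))=x^2-1$$ have a unique solution satisfying $\delta_b\le L(x)<R(x)\le1$. At $x=x_0$ this solution is $(L,R)=(\delta_0,1)$. As $x\downarrow-1$ it converges to $L=R=\delta_*$. Define maps $D,U$ on $[-1,1]$ by: - $D(x)=y(L(x))$, $U(x)=y(R(x))$ for $-1\le x\le x_0$, with $L(-1)=R(-1)=\delta_*$; - for $x_0\le x\le b$, parametrically $x=b-\delta+W(\delta)$, $D=z(\delta)-k$, $U=b-\delta+2W(\delta)$, $\delta\in[\delta_b,\delta_0]$; - for $b\le x\le1$, parametrically $x=z(\delta)$, $D=x-k$, $U=x+\delta$, $\delta\in[\delta_b,1]$. With $q(x)=\frac{x-D(x)}{U(x)-D(x)}$ for $x>-1$ and $q(-1)=\tfrac12$, these define a coupling $$\pi_k(\mathrm dx,\mathrm dy)=\mu(\mathrm dx)\big[(1-q(x))\delta_{D(x)}(\mathrm dy)+q(x)\delta_{U(x)}(\mathrm dy)\big]\in\mathcal M_k(\mu,\nu).$$ Moreover the maps are unique up to $\mu$-null sets among constructions with the prescribed transport from $[b,1]$ (that is, with $D,U$ on $[b,1]$ given by the third item), with $D$ decreasing and $U$ increasing on $[-1,b]$, and satisfying, for $-1\le x\le b$, $-2\le D(x)\le x\le U(x)\le\eta_b$ and $$\int_{D(x)}^{U(x)}\bar r(y)\,\mathrm dy=\frac{x+1}2,\qquad \int_{D(x)}^{U(x)}y\,\bar r(y)\,\mathrm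 dy=\frac{x^2-1}4 .$$
   Context: $\mu$ is uniform on $[-1,1]$, $\nu$ uniform on $[-2,2]$. $\mathcal M_k(\mu,\nu)$ is the set of Borel probability measures $\pi$ on $\mathbb R^2$ with marginals $\mu,\nu$, concentrated on $\{y\ge x-k\}$, whose conditional laws satisfy $\int y\,\pi_x(\mathrm dy)=x$ for $\mu$-a.e. $x$. Put $b=k-2$ and, for $0\le\delta\le1$, $z(\delta)=2-\delta+2k\log\frac{k-1}{k-\delta}$, $y(\delta)=z(\delta)-k$, $A(\delta)=(2-k)\delta-\frac{\delta^2}2+2k[\delta\log(k-1)+(k-\delta)\log(k-\delta)-(k-\delta)]$ (an antiderivative of $y$), $T(\delta)=A(1)-A(\delta)-\big(\frac{(1+\delta)^2}4-1\big)$, $\mathcal W(\delta)=b^2-2b(\delta-1)+2k[(k-\delta)\log\frac{k-\delta}{k-1}+\delta-1]$. The function $z$ is strictly increasing with $z(1)=1$; $\delta_b\in(0,1)$ is the unique solution of $z(\delta_b)=b$, so $y(\delta_b)=-2$, $y(1)=1-k$. $\delta_0$ is the unique zero of $T$ in $(\delta_b,1)$; $\mathcal W>0$ on $[\delta_b,\delta_0]$ and $W=\sqrt{\mathcal W}$ there. Put $x_0=-\frac{1+\delta_0}2$, and let $\delta_*\in(\delta_b,1)$ be the unique solution of $y(\delta_* )=-1$. Residual density: put $\eta_b=b+\delta_b$ and $p(z(\delta))=\frac{\delta}{k+\delta}$ for $\delta\in[\delta_b,1]$ (the lower weight $1-q$ of a source $x=z(\delta)\in[b,1]$). Then $\bar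 r(y)=\frac14-\frac12p(y+k)$ for $-2\le y\le1-k$, $\bar r(y)=\frac14$ for $1-k<y\le\eta_b$, and $\bar r(y)=0$ otherwise. *)

theory Defs
  imports "HOL-Probability.Probability"
begin

section \<open>Martingale couplings with a barrier\<close>

definition uniform_on :: "real \<Rightarrow> real \<Rightarrow> real measure" where
  "uniform_on a c = uniform_measure lborel {a..c}"

text \<open>A regular conditional law \<open>\<kappa>\<close> of the second coordinate given the first one, for a
  measure on the plane whose first marginal is \<open>\<mu>\<close>.\<close>

definition conditional_law ::
    "real measure \<Rightarrow> (real \<times> real) measure \<Rightarrow> (real \<Rightarrow> real measure) \<Rightarrow> bool" where
  "conditional_law \<mu> \<pi> \<kappa> \<longleftrightarrow>
     \<kappa> \<in> borel \<rightarrow>\<^sub>M prob_algebra borel \<and>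
     (\<forall>S\<in>sets borel. \<forall>B\<in>sets borel.
        emeasure \<pi> (S \<times> B) = (\<integral>\<^sup>+x. emeasure (\<kappa> x) B * indicator S x \<partial>\<mu>))"

text \<open>Conditional laws exist and are unique up to a \<open>\<mu>\<close>-null set, so it is immaterial which
  version is used in the martingale condition.  Integrability is required explicitly because the
  Bochner integral of a non-integrable function is \<open>0\<close> by convention.\<close>

definition barrier_couplings ::
    "real \<Rightarrow> real measure \<Rightarrow> real measure \<Rightarrow> (real \<times> real) measure set" where
  "barrier_couplings k \<mu> \<nu> = {\<pi>.
     prob_space \<pi> \<and> sets \<pi> = sets borel \<and>
     distr \<pi> borel fst = \<mu> \<and> distr \<pi> borel snd = \<nu> \<and>
     (AE (x, y) in \<pi>. y \<ge> x - k) \<and>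
     (\<exists>\<kappa>. conditional_law \<mu> \<pi> \<kappa> \<and>
          (AE x in \<mu>. integrable (\<kappa> x) (\<lambda>y. y) \<and> (\<integral>y. y \<partial>\<kappa> x) = x))}"

text \<open>The measure \<open>\<mu>(dx) [(1 - q x) \<delta>\<^bsub>D x\<^esub>(dy) + q x \<delta>\<^bsub>U x\<^esub>(dy)]\<close>.\<close>

definition two_point_coupling ::
    "real measure \<Rightarrow> (real \<Rightarrow> real) \<Rightarrow> (real \<Rightarrow> real) \<Rightarrow> (real \<Rightarrow> real) \<Rightarrow> (real \<times> real) measure" where
  "two_point_coupling \<mu> D U q = measure_of UNIV (sets borel)
     (\<lambda>S. \<integral>\<^sup>+x. ennreal (1 - q x) * indicator S (x, D x) + ennreal (q x) * indicator S (x, U x) \<partial>\<mu>)"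

definition up_weight :: "(real \<Rightarrow> real) \<Rightarrow> (real \<Rightarrow> real) \<Rightarrow> real \<Rightarrow> real" where
  "up_weight D U x = (if x = -1 then 1/2 else (x - D x) / (U x - D x))"


section \<open>The explicit data for uniform marginals\<close>

definition bpt :: "real \<Rightarrow> real" where
  "bpt k = k - 2"

definition zf :: "real \<Rightarrow> real \<Rightarrow> real" where
  "zf k \<delta> = 2 - \<delta> + 2 * k * ln ((k - 1) / (k - \<delta>))"

definition yf :: "real \<Rightarrow> real \<Rightarrow> real" where
  "yf k \<delta> = zf k \<delta> - k"

definition Af :: "real \<Rightarrow> real \<Rightarrow> real" where
  "Af k \<delta> = (2 - k) * \<delta> - \<delta>\<^sup>2 / 2
     + 2 * k * (\<delta> * ln (k - 1) + (k - \<delta>) * ln (k - \<delta>) - (k - \<delta>))"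

definition Tf :: "real \<Rightarrow> real \<Rightarrow> real" where
  "Tf k \<delta> = Af k 1 - Af k \<delta> - ((1 + \<delta>)\<^sup>2 / 4 - 1)"

definition Wsq :: "real \<Rightarrow> real \<Rightarrow> real" where
  "Wsq k \<delta> = (bpt k)\<^sup>2 - 2 * bpt k * (\<delta> - 1)
     + 2 * k * ((k - \<delta>) * ln ((k - \<delta>) / (k - 1)) + \<delta> - 1)"

definition Wf :: "real \<Rightarrow> real \<Rightarrow> real" where
  "Wf k \<delta> = sqrt (Wsq k \<delta>)"

text \<open>For \<open>1 < k < 2\<close> each of the following three descriptions has exactly one solution.\<close>

definition delta_b :: "real \<Rightarrow> real" where
  "delta_b k = (THE \<delta>. 0 < \<delta> \<and> \<delta> < 1 \<and> zf k \<delta> = bpt k)"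

definition delta_0 :: "real \<Rightarrow> real" where
  "delta_0 k = (THE \<delta>. delta_b k < \<delta> \<and> \<delta> < 1 \<and> Tf k \<delta> = 0)"

definition delta_star :: "real \<Rightarrow> real" where
  "delta_star k = (THE \<delta>. delta_b k < \<delta> \<and> \<delta> < 1 \<and> yf k \<delta> = -1)"

definition x0 :: "real \<Rightarrow> real" where
  "x0 k = - (1 + delta_0 k) / 2"

definition eta_b :: "real \<Rightarrow> real" where
  "eta_b k = bpt k + delta_b k"

text \<open>The function \<open>p\<close> with \<open>p (z \<delta>) = \<delta> / (k + \<delta>)\<close> for \<open>\<delta>\<close> in \<open>[\<delta>\<^sub>b, 1]\<close>; \<open>z\<close> is injective
  there.\<close>

definition down_weight :: "real \<Rightarrow> real \<Rightarrow> real" where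
  "down_weight k x = (let \<delta> = the_inv_into {delta_b k..1} (zf k) x in \<delta> / (k + \<delta>))"

definition rbar :: "real \<Rightarrow> real \<Rightarrow> real" where
  "rbar k y = (if -2 \<le> y \<and> y \<le> 1 - k then 1/4 - 1/2 * down_weight k (y + k)
               else if 1 - k < y \<and> y \<le> eta_b k then 1/4
               else 0)"


section \<open>The maps\<close>

definition LR_solution :: "real \<Rightarrow> real \<Rightarrow> real \<Rightarrow> real \<Rightarrow> bool" where
  "LR_solution k x L R \<longleftrightarrow>
     delta_b k \<le> L \<and> L < R \<and> R \<le> 1 \<and>
     R - L = 2 * (x + 1) \<and> Af k R - Af k L = x\<^sup>2 - 1"

definition Lf :: "real \<Rightarrow> real \<Rightarrow> real" where
  "Lf k x = (if x = -1 then delta_star k else fst (THE (L, R). LR_solution k x L R))"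

definition Rf :: "real \<Rightarrow> real \<Rightarrow> real" where
  "Rf k x = (if x = -1 then delta_star k else snd (THE (L, R). LR_solution k x L R))"

definition mid_source :: "real \<Rightarrow> real \<Rightarrow> real" where
  "mid_source k \<delta> = bpt k - \<delta> + Wf k \<delta>"

definition left_piece :: "real \<Rightarrow> (real \<Rightarrow> real) \<Rightarrow> (real \<Rightarrow> real) \<Rightarrow> bool" where
  "left_piece k D U \<longleftrightarrow>
     (\<forall>x\<in>{-1..x0 k}. D x = yf k (Lf k x) \<and> U x = yf k (Rf k x))"

definition mid_piece :: "real \<Rightarrow> (real \<Rightarrow> real) \<Rightarrow> (real \<Rightarrow> real) \<Rightarrow> bool" where
  "mid_piece k D U \<longleftrightarrow>
     (\<forall>\<delta>\<in>{delta_b k..delta_0 k}.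
        D (mid_source k \<delta>) = zf k \<delta> - k \<and>
        U (mid_source k \<delta>) = bpt k - \<delta> + 2 * Wf k \<delta>)"

definition right_piece :: "real \<Rightarrow> (real \<Rightarrow> real) \<Rightarrow> (real \<Rightarrow> real) \<Rightarrow> bool" where
  "right_piece k D U \<longleftrightarrow>
     (\<forall>\<delta>\<in>{delta_b k..1}. D (zf k \<delta>) = zf k \<delta> - k \<and> U (zf k \<delta>) = zf k \<delta> + \<delta>)"

text \<open>\<open>D\<close> and \<open>U\<close> are total functions in HOL; only their values on \<open>[-1, 1]\<close> are meant.  The
  pieces share the points \<open>x\<^sub>0\<close> and \<open>b\<close>, so satisfiability includes agreement there.\<close>

definition glued_maps :: "real \<Rightarrow> (real \<Rightarrow> real) \<Rightarrow> (real \<Rightarrow> real) \<Rightarrow> bool" where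
  "glued_maps k D U \<longleftrightarrow> left_piece k D U \<and> mid_piece k D U \<and> right_piece k D U"

text \<open>The competitors in the uniqueness claim.  Monotonicity is in the weak sense.\<close>

definition monotone_construction :: "real \<Rightarrow> (real \<Rightarrow> real) \<Rightarrow> (real \<Rightarrow> real) \<Rightarrow> bool" where
  "monotone_construction k D U \<longleftrightarrow>
     right_piece k D U \<and>
     antimono_on {-1..bpt k} D \<and> mono_on {-1..bpt k} U \<and>
     (\<forall>x\<in>{-1..bpt k}.
        -2 \<le> D x \<and> D x \<le> x \<and> x \<le> U x \<and> U x \<le> eta_b k \<and>
        integral {D x..U x} (rbar k) = (x + 1) / 2 \<and>
        integral {D x..U x} (\<lambda>y. y * rbar k y) = (x\<^sup>2 - 1) / 4)"

end

theory Submission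
  imports Defs
begin

text \<open>
  Continue the parameter \<open>\<delta>\<close> past \<open>1\<close> so that \<open>y(\<delta>)\<close> has slope \<open>1\<close> there.  In this coordinate the
  residual density becomes the constant \<open>1/4\<close>, and on all of \<open>[-1, b]\<close>, not only on \<open>[-1, x\<^sub>0]\<close>, the
  mass and moment conditions for \<open>D = y(L)\<close>, \<open>U = y(R)\<close> read \<open>R - L = 2(x + 1)\<close> and
  \<open>A(R) - A(L) = x\<^sup>2 - 1\<close>, with \<open>A' = y\<close>; the middle piece is their explicit solution with \<open>R \<ge> 1\<close>.
  Since \<open>y\<close> has slope at least \<open>1\<close>, a convexity argument gives uniqueness, \<open>D < -1\<close> and \<open>x < U\<close> for
  \<open>x > -1\<close>, and monotonicity and Lipschitz continuity of \<open>L\<close> and \<open>R\<close>.  Uniqueness among monotone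
  constructions is thereby already pointwise.

  Differentiating the two equations yields \<open>R' = 2q\<close> and \<open>L' = -2(1 - q)\<close>.  Hence \<open>U\<close> and \<open>D\<close> push
  the weights \<open>q/2\<close> and \<open>(1 - q)/2\<close> on \<open>[-1, b]\<close> forward to the residual density above and below
  \<open>-1\<close>, while on \<open>[b, 1]\<close> they are pushed to \<open>1/4\<close> on \<open>[\<eta>\<^sub>b, 2]\<close> and to \<open>p/2\<close> on \<open>[-2, 1 - k]\<close>.  The
  four pieces add up to the density \<open>1/4\<close> of \<open>\<nu>\<close>.
\<close>

section \<open>Two-point couplings\<close>

lemma has_integral_imp_nn_integral:
  fixes w :: "real \<Rightarrow> real"
  assumes "w \<in> borel_measurable borel" "\<And>x. 0 \<le> w x" "(w has_integral I) {a..c}"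
  shows "(\<integral>\<^sup>+x. ennreal (w x) * indicator {a..c} x \<partial>lborel) = ennreal I"
proof -
  have "((\<lambda>x. if x \<in> {a..c} then w x else 0) has_integral I) UNIV"
    using assms(3) by (simp only: has_integral_restrict_UNIV)
  then have "(\<integral>\<^sup>+x. ennreal (if x \<in> {a..c} then w x else 0) \<partial>lborel) = ennreal I"
    using assms by (intro nn_integral_has_integral_lborel) auto
  also have "(\<lambda>x. ennreal (if x \<in> {a..c} then w x else 0)) = (\<lambda>x. ennreal (w x) * indicator {a..c} x)"
    by (auto simp: indicator_def)
  finally show ?thesis .
qed

text \<open>Distribution function of the image of \<open>w dx\<close> under \<open>f\<close>:
  sublevel sets are initial intervals, so it suffices to know the primitive of \<open>w\<close>,
  written as \<open>G\<close> in the image variable. Clamping \<open>y\<close> to the range of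
  \<open>f\<close> treats all \<open>y\<close> in one formula.\<close>

lemma nn_integral_sublevel_incr:
  fixes f w G :: "real \<Rightarrow> real"
  assumes w: "w \<in> borel_measurable borel" "\<And>x. 0 \<le> w x"
    and ac: "a \<le> c" and f: "continuous_on {a..c} f" "strict_mono_on {a..c} f"
    and G: "\<And>x. x \<in> {a..c} \<Longrightarrow> (w has_integral G (f x) - G (f a)) {a..x}"
  shows "(\<integral>\<^sup>+x. ennreal (w x) * indicator {x\<in>{a..c}. f x \<le> y} x \<partial>lborel)
    = ennreal (G (max (f a) (min y (f c))) - G (f a))"
proof -
  have mono: "f x \<le> f x' \<longleftrightarrow> x \<le> x'" if "x \<in> {a..c}" "x' \<in> {a..c}" for x x'
    using strict_mono_on_leD[OF f(2), of x x'] strict_mono_onD[OF f(2), of x' x] that by fastforce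
  \<comment> \<open>Either \<open>y\<close> lies below the range, or the sublevel set ends at a
    preimage of the clamped \<open>y\<close>; that preimage is \<open>c\<close> or comes from the
    intermediate value theorem.\<close>
  consider "y < f a" | x where "x \<in> {a..c}" "max (f a) (min y (f c)) = f x" "{z\<in>{a..c}. f z \<le> y} = {a..x}"
  proof (cases "y < f a"; cases "f c \<le> y")
    assume "\<not> y < f a" "f c \<le> y"
    moreover have "f z \<le> y" if "z \<in> {a..c}" for z
      using mono[of z c] that ac \<open>f c \<le> y\<close> by auto
    ultimately have "{z\<in>{a..c}. f z \<le> y} = {a..c}" by blast
    then show thesis using that(2)[of c] ac mono[of a c] \<open>f c \<le> y\<close> by auto
  next
    assume y: "\<not> y < f a" "\<not> f c \<le> y"
    then have "\<exists>x. a \<le> x \<and> x \<le> c \<and> f x = y"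
      using ac f(1) by (intro IVT') auto
    then obtain x where x: "x \<in> {a..c}" "f x = y" by auto
    have "{z\<in>{a..c}. f z \<le> y} = {a..x}" using mono x by force
    then show thesis using that(2)[of x] x y by auto
  qed (auto intro: that)
  then show ?thesis
  proof cases
    case 1
    then have "{z\<in>{a..c}. f z \<le> y} = {}"
      using mono[of a] ac by fastforce
    then show ?thesis using 1 mono[of a c] ac by simp
  next
    case 2
    then show ?thesis using has_integral_imp_nn_integral[OF w G[OF 2(1)]] by simp
  qed
qed

text \<open>Mirror image: sublevel sets are now final intervals, so the primitive is normalised at
  \<open>c\<close>.\<close>

lemma nn_integral_sublevel_decr:
  fixes f w G :: "real \<Rightarrow> real"
  assumes w: "w \<in> borel_measurable borel" "\<And>x. 0 \<le> w x"
    and ac: "a \<le> c" and f: "continuous_on {a..c} f" 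
      "\<And>x x'. a \<le> x \<Longrightarrow> x < x' \<Longrightarrow> x' \<le> c \<Longrightarrow> f x' < f x"
    and G: "\<And>x. x \<in> {a..c} \<Longrightarrow> (w has_integral G (f x) - G (f c)) {x..c}"
  shows "(\<integral>\<^sup>+x. ennreal (w x) * indicator {x\<in>{a..c}. f x \<le> y} x \<partial>lborel)
    = ennreal (G (max (f c) (min y (f a))) - G (f c))"
proof -
  have mono: "f x \<le> f x' \<longleftrightarrow> x' \<le> x" if "x \<in> {a..c}" "x' \<in> {a..c}" for x x'
    using f(2)[of x x'] f(2)[of x' x] that by (cases x x' rule: linorder_cases) auto
  consider "y < f c" | x where "x \<in> {a..c}" "max (f c) (min y (f a)) = f x" "{z\<in>{a..c}. f z \<le> y} = {x..c}"
  proof (cases "y < f c"; cases "f a \<le> y")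
    assume "\<not> y < f c" "f a \<le> y"
    moreover have "f z \<le> y" if "z \<in> {a..c}" for z
      using mono[of z a] that ac \<open>f a \<le> y\<close> by auto
    ultimately have "{z\<in>{a..c}. f z \<le> y} = {a..c}" by blast
    then show thesis using that(2)[of a] ac mono[of c a] \<open>f a \<le> y\<close> by auto
  next
    assume y: "\<not> y < f c" "\<not> f a \<le> y"
    then have "\<exists>x. a \<le> x \<and> x \<le> c \<and> f x = y"
      using ac f(1) by (intro IVT2') auto
    then obtain x where x: "x \<in> {a..c}" "f x = y" by auto
    have "{z\<in>{a..c}. f z \<le> y} = {x..c}" using mono x by force
    then show thesis using that(2)[of x] x y by auto
  qed (auto intro: that)
  then show ?thesis
  proof cases
    case 1
    then have "{z\<in>{a..c}. f z \<le> y} = {}"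
      using mono[of c] ac by fastforce
    then show ?thesis using 1 mono[of c a] ac by simp
  next
    case 2
    then show ?thesis using has_integral_imp_nn_integral[OF w G[OF 2(1)]] by simp
  qed
qed

section \<open>Two-point couplings as measures on the plane\<close>

lemma sets_two_point_coupling: "sets (two_point_coupling \<mu> D U q) = sets borel"
  using sets.sigma_sets_eq[of "borel :: (real \<times> real) measure"]
  by (simp add: two_point_coupling_def)

text \<open>The set functions handed to \<open>measure_of\<close> already coincide. Hence glued
  maps, which are unconstrained outside \<open>[-1, 1]\<close> and may be non-measurable there, can
  be exchanged for Borel versions.\<close>

lemma two_point_coupling_cong_AE:
  assumes "AE x in \<mu>. D x = D' x \<and> U x = U' x \<and> q x = q' x"
  shows "two_point_coupling \<mu> D U q = two_point_coupling \<mu> D' U' q'"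
proof -
  have "(\<integral>\<^sup>+x. ennreal (1 - q x) * indicator S (x, D x) + ennreal (q x) * indicator S (x, U x) \<partial>\<mu>)
    = (\<integral>\<^sup>+x. ennreal (1 - q' x) * indicator S (x, D' x) + ennreal (q' x) * indicator S (x, U' x) \<partial>\<mu>)" for S
    using assms by (intro nn_integral_cong_AE) (auto elim: eventually_mono)
  then show ?thesis by (simp add: two_point_coupling_def)
qed

text \<open>\<open>measure_of\<close> returns the given set function only once that is known to be
  countably additive; here this is the interchange of sum and integral.\<close>

lemma emeasure_two_point_coupling:
  fixes D U q :: "real \<Rightarrow> real"
  assumes [measurable]: "D \<in> borel_measurable borel" "U \<in> borel_measurable borel" "q \<in> borel_measurable borel"
    and \<mu> [measurable_cong]: "sets \<mu> = sets borel" and S: "S \<in> sets borel"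
  shows "emeasure (two_point_coupling \<mu> D U q) S
    = (\<integral>\<^sup>+x. ennreal (1 - q x) * indicator S (x, D x) + ennreal (q x) * indicator S (x, U x) \<partial>\<mu>)"
  unfolding two_point_coupling_def
proof (rule emeasure_measure_of_sigma[OF _ _ _ S])
  show "sigma_algebra UNIV (sets borel :: (real \<times> real) set set)"
    using sets.sigma_algebra_axioms[of borel] by simp
  let ?F = "\<lambda>S. \<integral>\<^sup>+x. ennreal (1 - q x) * indicator S (x, D x) + ennreal (q x) * indicator S (x, U x) \<partial>\<mu>"
  show "positive (sets borel) ?F"
    by (simp add: positive_def)
  show "countably_additive (sets borel) ?F"
  proof (rule countably_additiveI)
    fix A :: "nat \<Rightarrow> (real \<times> real) set"
    assume A: "range A \<subseteq> sets borel" "disjoint_family A"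
    have [measurable]: "A i \<in> sets borel" for i using A by auto
    have [measurable]: "A i \<in> sets (borel \<Otimes>\<^sub>M borel)" for i
      unfolding borel_prod using A by auto
    have "(\<Sum>i. ?F (A i)) = (\<integral>\<^sup>+x. (\<Sum>i. ennreal (1 - q x) * indicator (A i) (x, D x)
        + ennreal (q x) * indicator (A i) (x, U x)) \<partial>\<mu>)"
      by (rule nn_integral_suminf[symmetric]) measurable
    also have "\<dots> = ?F (\<Union>i. A i)"
      by (intro nn_integral_cong) 
         (simp add: suminf_add[symmetric] ennreal_suminf_cmult suminf_indicator[OF A(2)])
    finally show "(\<Sum>i. ?F (A i)) = ?F (\<Union>i. A i)" .
  qed
qed

text \<open>Encoded as the image of a Bernoulli law, so that integrability and the mean reduce to
  finite sums.\<close>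

definition two_point_law :: "real \<Rightarrow> real \<Rightarrow> real \<Rightarrow> real measure" where
  "two_point_law d u q = distr (measure_pmf (bernoulli_pmf q)) borel (\<lambda>c. if c then u else d)"

lemma two_point_law:
  assumes "0 \<le> q" "q \<le> 1"
  shows "prob_space (two_point_law d u q)" "sets (two_point_law d u q) = sets borel"
    and "B \<in> sets borel \<Longrightarrow> emeasure (two_point_law d u q) B = ennreal (1 - q) * indicator B d + ennreal q * indicator B u"
    and "integrable (two_point_law d u q) (\<lambda>y. y)"
    and "(\<integral>y. y \<partial>two_point_law d u q) = (1 - q) * d + q * u"
proof -
  show "prob_space (two_point_law d u q)" "sets (two_point_law d u q) = sets borel"
    unfolding two_point_law_def by (auto intro!: prob_space.prob_space_distr measure_pmf.prob_space_axioms)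
  show "integrable (two_point_law d u q) (\<lambda>y. y)"
    unfolding two_point_law_def by (subst integrable_distr_eq) (auto intro: integrable_measure_pmf_finite)
  show "(\<integral>y. y \<partial>two_point_law d u q) = (1 - q) * d + q * u"
    unfolding two_point_law_def by (subst integral_distr) (use assms in auto)
  assume B: "B \<in> sets borel"
  have "emeasure (two_point_law d u q) B = (\<integral>\<^sup>+y. indicator B y \<partial>two_point_law d u q)"
    using B by (subst nn_integral_indicator) (auto simp: two_point_law_def)
  also have "\<dots> = (\<integral>\<^sup>+c. indicator B (if c then u else d) \<partial>measure_pmf (bernoulli_pmf q))"
    unfolding two_point_law_def using B by (subst nn_integral_distr) auto
  also have "\<dots> = ennreal (1 - q) * indicator B d + ennreal q * indicator B u"
    using assms by (simp add: mult.commute add.commute)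
  finally show "emeasure (two_point_law d u q) B = ennreal (1 - q) * indicator B d + ennreal q * indicator B u" .
qed

text \<open>Reduces membership to pointwise conditions and one distribution function: the first
  marginal is \<open>\<mu>\<close> because the weights add up to 1, the second is determined by its
  distribution function, and \<open>two_point_law\<close> is the conditional law.\<close>

lemma two_point_coupling_in_barrier_couplings:
  fixes D U q :: "real \<Rightarrow> real"
  assumes [measurable]: "D \<in> borel_measurable borel" "U \<in> borel_measurable borel" "q \<in> borel_measurable borel"
    and q: "\<And>x. 0 \<le> q x" "\<And>x. q x \<le> 1"
    and \<mu>: "prob_space \<mu>" and sets_\<mu> [measurable_cong]: "sets \<mu> = sets borel"
    and \<nu>: "real_distribution \<nu>"
    and barrier: "AE x in \<mu>. x - k \<le> D x \<and> x - k \<le> U x"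
    and mean: "AE x in \<mu>. (1 - q x) * D x + q x * U x = x"
    and cdf: "\<And>y. (\<integral>\<^sup>+x. ennreal (1 - q x) * indicator {..y} (D x) + ennreal (q x) * indicator {..y} (U x) \<partial>\<mu>)
        = emeasure \<nu> {..y}"
  shows "two_point_coupling \<mu> D U q \<in> barrier_couplings k \<mu> \<nu>"
proof -
  interpret \<mu>: prob_space \<mu> by fact
  let ?\<pi> = "two_point_coupling \<mu> D U q"
  have space_\<mu>: "space \<mu> = UNIV" using sets_eq_imp_space_eq[OF sets_\<mu>] by simp
  note sets_\<pi> [measurable_cong] = sets_two_point_coupling[of \<mu> D U q]
  have space_\<pi>: "space ?\<pi> = UNIV" using sets_eq_imp_space_eq[OF sets_\<pi>] by simp
  note em = emeasure_two_point_coupling[OF assms(1-3) sets_\<mu>]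
  have split: "ennreal (1 - q x) * c + ennreal (q x) * c = c" for x c
    using q[of x] by (simp add: distrib_right[symmetric] ennreal_plus[symmetric] del: ennreal_plus)
  have fst_sets: "fst -` S \<in> sets (borel :: (real \<times> real) measure)" 
    and snd_sets: "snd -` S \<in> sets (borel :: (real \<times> real) measure)" 
    if "S \<in> sets borel" for S :: "real set"
  proof -
    have "fst \<in> borel_measurable (borel :: (real \<times> real) measure)"
      "snd \<in> borel_measurable (borel :: (real \<times> real) measure)"
      by (auto intro!: borel_measurable_continuous_onI continuous_intros)
    from this[THEN measurable_sets, OF that]
    show "fst -` S \<in> sets (borel :: (real \<times> real) measure)" "snd -` S \<in> sets (borel :: (real \<times> real) measure)"
      by auto
  qed
  have ind: "indicator (f -` S) p = (indicator S (f p) :: ennreal)" for f :: "real \<times> real \<Rightarrow> real" and S p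
    by (simp add: indicator_def)
  have prob: "prob_space ?\<pi>"
    using split[of _ 1] by (intro prob_spaceI) (simp add: space_\<pi> em \<mu>.emeasure_space_1)
  have marg1: "distr ?\<pi> borel fst = \<mu>"
  proof (rule measure_eqI)
    fix S assume "S \<in> sets (distr ?\<pi> borel fst)"
    then have [measurable]: "S \<in> sets borel" by simp
    have "emeasure (distr ?\<pi> borel fst) S = emeasure ?\<pi> (fst -` S)"
      by (subst emeasure_distr) (auto simp: space_\<pi> borel_prod[symmetric] measurable_cong_sets[OF sets_\<pi> refl])
    also have "\<dots> = (\<integral>\<^sup>+x. indicator S x \<partial>\<mu>)"
      by (subst em) (auto simp: split fst_sets ind)
    also have "\<dots> = emeasure \<mu> S" by simp
    finally show "emeasure (distr ?\<pi> borel fst) S = emeasure \<mu> S" .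
  qed (simp add: sets_\<mu>)
  have snd_meas: "snd \<in> ?\<pi> \<rightarrow>\<^sub>M borel"
    by (auto simp: borel_prod[symmetric] measurable_cong_sets[OF sets_\<pi> refl])
  have marg2: "distr ?\<pi> borel snd = \<nu>"
  proof (rule cdf_unique[OF _ \<nu>])
    interpret \<pi>: prob_space ?\<pi> by fact
    show "real_distribution (distr ?\<pi> borel snd)"
      using snd_meas by (intro \<pi>.real_distribution_distr) 
    show "cdf (distr ?\<pi> borel snd) = cdf \<nu>"
    proof
      fix y
      have "emeasure (distr ?\<pi> borel snd) {..y} = emeasure ?\<pi> (snd -` {..y})"
        using snd_meas by (subst emeasure_distr) (auto simp: space_\<pi>)
      also have "\<dots> = emeasure \<nu> {..y}"
        by (subst em) (auto simp: snd_sets cdf[symmetric] ind)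
      finally show "cdf (distr ?\<pi> borel snd) y = cdf \<nu> y"
        by (simp add: cdf_def2 measure_def)
    qed
  qed
  let ?N = "{p. snd p < fst p - k} :: (real \<times> real) set"
  have N: "?N \<in> sets borel"
    by (intro borel_open open_Collect_less continuous_intros)
  have "emeasure ?\<pi> ?N = (\<integral>\<^sup>+x. 0 \<partial>\<mu>)"
    unfolding em[OF N]
  proof (rule nn_integral_cong_AE)
    show "AE x in \<mu>. ennreal (1 - q x) * indicator ?N (x, D x) + ennreal (q x) * indicator ?N (x, U x) = 0"
      using barrier
    proof eventually_elim
      case (elim x)
      then have "(x, D x) \<notin> ?N" "(x, U x) \<notin> ?N" by auto
      then show ?case by simp
    qed
  qed
  then have ae: "AE (x, y) in ?\<pi>. x - k \<le> y"
    using N by (intro AE_I[where N = ?N]) (auto simp: sets_\<pi>)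
  let ?\<kappa> = "\<lambda>x. two_point_law (D x) (U x) (q x)"
  note law = two_point_law[OF q]
  have "conditional_law \<mu> ?\<pi> ?\<kappa>"
    unfolding conditional_law_def
  proof (intro conjI ballI)
    show "?\<kappa> \<in> borel \<rightarrow>\<^sub>M prob_algebra borel"
    proof (intro measurable_prob_algebraI measurable_subprob_algebra)
      fix A :: "real set" assume [measurable]: "A \<in> sets borel"
      show "(\<lambda>x. emeasure (?\<kappa> x) A) \<in> borel_measurable borel"
        by (subst law(3)) auto
    qed (simp_all add: law(1,2) prob_space_imp_subprob_space)
    fix S B :: "real set" assume SB [measurable]: "S \<in> sets borel" "B \<in> sets borel"
    have "S \<times> B \<in> sets borel" by (simp add: borel_prod[symmetric])
    then show "emeasure ?\<pi> (S \<times> B) = (\<integral>\<^sup>+x. emeasure (?\<kappa> x) B * indicator S x \<partial>\<mu>)"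
      by (subst em) (auto simp: law(3) indicator_times algebra_simps intro!: nn_integral_cong)
  qed
  moreover have "AE x in \<mu>. integrable (?\<kappa> x) (\<lambda>y. y) \<and> (\<integral>y. y \<partial>?\<kappa> x) = x"
    using mean by (auto elim!: eventually_mono simp: law)
  ultimately show ?thesis
    unfolding barrier_couplings_def using prob sets_\<pi> marg1 marg2 ae by auto
qed

section \<open>The parameters\<close>

text \<open>The first Pade approximant of \<open>ln\<close> at 1; the difference has derivative
  \<open>(x - 1)^2 / (x * (x + 1)^2)\<close>. The numerical bounds on \<open>delta_b\<close> and
  \<open>delta_0\<close> rest on it.\<close>

lemma ln_ge_rational:
  fixes r :: real
  assumes "1 \<le> r"
  shows "2 * (r - 1) / (r + 1) \<le> ln r"
proof -
  have "ln 1 - 2 * (1 - 1) / (1 + 1) \<le> ln r - 2 * (r - 1) / (r + 1)"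
  proof (rule DERIV_nonneg_imp_nondecreasing[OF assms])
    fix x :: real assume x: "1 \<le> x" "x \<le> r"
    have "((\<lambda>r. ln r - 2 * (r - 1) / (r + 1)) has_real_derivative
        1 / x - (2 * (x + 1) - 2 * (x - 1)) / ((x + 1) * (x + 1))) (at x)"
      using x by (auto intro!: derivative_eq_intros)
    moreover have "1 / x - (2 * (x + 1) - 2 * (x - 1)) / ((x + 1) * (x + 1))
        = (x - 1)\<^sup>2 / (x * (x + 1)\<^sup>2)"
    proof -
      have "x \<noteq> 0" "x + 1 \<noteq> 0" using x by auto
      then show ?thesis by (simp add: divide_simps power2_eq_square) algebra
    qed
    ultimately show "\<exists>y. ((\<lambda>r. ln r - 2 * (r - 1) / (r + 1)) has_real_derivative y) (at x) \<and> 0 \<le> y"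
      using x by (intro exI[of _ "(x - 1)\<^sup>2 / (x * (x + 1)\<^sup>2)"]) auto
  qed
  then show ?thesis by simp
qed

locale uniform_barrier =
  fixes k :: real
  assumes k1: "1 < k" and k2: "k < 2"
begin

abbreviation "b \<equiv> bpt k"
abbreviation "db \<equiv> delta_b k"
abbreviation "d0 \<equiv> delta_0 k"
abbreviation "ds \<equiv> delta_star k"

section \<open>The function \<open>z\<close> and the parameters \<open>delta_b\<close> and
  \<open>delta_star\<close>\<close>

lemma b_eq: "b = k - 2"
  by (simp add: bpt_def)

lemma zf_1 [simp]: "zf k 1 = 1"
  using k1 by (simp add: zf_def)

lemma yf_1: "yf k 1 = 1 - k"
  by (simp add: yf_def)

lemma zf_deriv:
  assumes "t < k"
  shows "(zf k has_real_derivative (k + t) / (k - t)) (at t)"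
proof -
  have "((\<lambda>t. ln ((k - 1) / (k - t))) has_real_derivative 1 / (k - t)) (at t)"
    using assms k1
    by (auto intro!: derivative_eq_intros simp: divide_simps)
  from DERIV_add[OF DERIV_diff[OF DERIV_const[of 2] DERIV_ident] DERIV_cmult[OF this, of "2 * k"]]
  have "(zf k has_real_derivative - 1 + 2 * k * (1 / (k - t))) (at t)"
    by (simp add: zf_def[abs_def])
  moreover have "- 1 + 2 * k * (1 / (k - t)) = (k + t) / (k - t)"
    using assms by (simp add: field_simps)
  ultimately show ?thesis by simp
qed

lemma zf_strict_mono:
  assumes "-k < s" "s < t" "t < k"
  shows "zf k s < zf k t"
proof (rule DERIV_pos_imp_increasing[OF assms(2)])
  fix x assume "s \<le> x" "x \<le> t"
  then show "\<exists>y. (zf k has_real_derivative y) (at x) \<and> 0 < y"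
    using assms zf_deriv[of x] by (intro exI[of _ "(k + x) / (k - x)"]) auto
qed

text \<open>The slope \<open>(k + x) / (k - x)\<close> is at least 1 for \<open>x \<ge> 0\<close>.
  This is the source of the convexity of \<open>excess\<close> and of the Lipschitz bounds for the
  inverse functions.\<close>

lemma zf_expanding:
  assumes "0 \<le> s" "s \<le> t" "t < k"
  shows "t - s \<le> zf k t - zf k s"
proof -
  have "zf k s - s \<le> zf k t - t"
  proof (rule DERIV_nonneg_imp_nondecreasing[OF assms(2)])
    fix x assume x: "s \<le> x" "x \<le> t"
    have "((\<lambda>a. zf k a - a) has_real_derivative (k + x) / (k - x) - 1) (at x)"
      using x assms by (auto intro!: derivative_eq_intros zf_deriv)
    moreover have "0 \<le> (k + x) / (k - x) - 1"
      using x assms by (simp add: field_simps)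
    ultimately show "\<exists>y. ((\<lambda>a. zf k a - a) has_real_derivative y) (at x) \<and> 0 \<le> y"
      by blast
  qed
  then show ?thesis by simp
qed

text \<open>Replaces the logarithm by a rational function, which turns sign questions about
  \<open>z\<close> at test points into polynomial inequalities.\<close>

lemma zf_upper:
  assumes "t \<le> 1"
  shows "zf k t \<le> 2 - t - 4 * k * (1 - t) / (2 * k - 1 - t)"
proof -
  let ?r = "(k - t) / (k - 1)"
  have r: "1 \<le> ?r" using assms k1 by simp
  have "ln ((k - 1) / (k - t)) = - ln ?r"
    using assms k1 by (simp add: ln_div)
  moreover have "2 * (?r - 1) / (?r + 1) = 2 * (1 - t) / (2 * k - 1 - t)"
  proof -
    have *: "k - 1 \<noteq> 0" "2 * k - 1 - t \<noteq> 0" using assms k1 by auto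
    then have "?r - 1 = (1 - t) / (k - 1)" "?r + 1 = (2 * k - 1 - t) / (k - 1)"
      by (auto simp: divide_simps)
    then show ?thesis using * by simp
  qed
  ultimately have "2 * k * ln ((k - 1) / (k - t)) \<le> 2 * k * (- (2 * (1 - t) / (2 * k - 1 - t)))"
    using ln_ge_rational[OF r] k1 by (intro mult_left_mono) auto
  moreover have "2 * k * (- (2 * (1 - t) / (2 * k - 1 - t))) = - (4 * k * (1 - t) / (2 * k - 1 - t))"
    by simp
  ultimately show ?thesis unfolding zf_def by linarith
qed

lemma zf_inject:
  assumes "-k < s" "s < k" "-k < t" "t < k"
  shows "zf k s = zf k t \<longleftrightarrow> s = t"
  using zf_strict_mono[of s t] zf_strict_mono[of t s] assms by (cases s t rule: linorder_cases) auto

lemma zf_continuous: "continuous_on {..<k} (zf k)"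
  by (rule DERIV_continuous_on[where D = "\<lambda>t. (k + t) / (k - t)"])
     (rule has_field_derivative_at_within[OF zf_deriv], simp)

lemma zf_0_less_b: "zf k 0 < b"
proof -
  have "2 - 4 * k / (2 * k - 1) < k - 2"
  proof -
    \<comment> \<open>Completed square of twice
      \<open>4 * k - (4 - k) * (2 * k - 1)\<close>.\<close>
    have "0 < (2 * k - 5 / 2)\<^sup>2 + 7 / 4" by (intro add_nonneg_pos) auto
    then have "(4 - k) * (2 * k - 1) < 4 * k" by (simp add: power2_eq_square algebra_simps)
    then have "4 - k < 4 * k / (2 * k - 1)" using k1 by (simp add: pos_less_divide_eq)
    then show ?thesis by simp
  qed
  then show ?thesis using zf_upper[of 0] by (simp add: b_eq)
qed

lemma delta_b_ex1: "\<exists>!d. 0 < d \<and> d < 1 \<and> zf k d = b"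
proof -
  have "\<exists>d. 0 \<le> d \<and> d \<le> 1 \<and> zf k d = b"
    using zf_0_less_b k1 k2 
    by (intro IVT') (auto simp: b_eq intro: continuous_on_subset[OF zf_continuous])
  then obtain d where d: "0 \<le> d" "d \<le> 1" "zf k d = b" by blast
  have "d \<noteq> 0" "d \<noteq> 1" using d zf_0_less_b k2 by (auto simp: b_eq)
  with d have "0 < d \<and> d < 1 \<and> zf k d = b" by auto
  moreover have "d' = d" if "0 < d' \<and> d' < 1 \<and> zf k d' = b" for d'
    by (rule iffD1[OF zf_inject]) (use that d k1 in auto)
  ultimately show ?thesis by (rule ex1I)
qed

lemma delta_b: "0 < db" "db < 1" "zf k db = b"
  using theI'[OF delta_b_ex1] by (auto simp: delta_b_def)

lemma yf_db: "yf k db = -2"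
  by (simp add: yf_def delta_b b_eq)

lemma delta_b_greater:
  assumes "-k < t" "t < 1" "zf k t < b"
  shows "t < db"
  using assms zf_strict_mono[of db t] delta_b k1 by (cases db t rule: linorder_cases) auto

text \<open>The test points are the values of \<open>db\<close> at which the two factors of
  \<open>Tf k db\<close> in \<open>Tf_db\<close> vanish. The first bound also gives
  \<open>x0 k < b\<close> and \<open>1 - k < eta_b k\<close>.\<close>

lemma delta_b_lower: "3 - 2 * k < db" "(2 * k - 3) / 3 < db"
proof -
  show "3 - 2 * k < db"
  proof (rule delta_b_greater)
    \<comment> \<open>With this value the rational bound reads
      \<open>zf k (3 - 2 * k) \<le> -1\<close>, and \<open>-1 < b\<close>.\<close>
    have "4 * k * (1 - (3 - 2 * k)) / (2 * k - 1 - (3 - 2 * k)) = 2 * k"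
      using k1 by (simp add: field_simps)
    then show "zf k (3 - 2 * k) < b"
      using zf_upper[of "3 - 2 * k"] k1 by (simp add: b_eq)
  qed (use k1 k2 in auto)
  define t where "t = (2 * k - 3) / 3"
  have "t < db"
  proof (rule delta_b_greater)
    have t: "3 * t = 2 * k - 3" by (simp add: t_def)
    have e: "4 * k * (1 - t) / (2 * k - 1 - t) = 6 - 2 * k"
      using k1 by (simp add: field_simps t_def)
    have "t \<le> 1" using k2 t by simp
    from zf_upper[OF this] have "zf k t \<le> 2 - t - (6 - 2 * k)" unfolding e .
    then show "zf k t < b"
      using k2 t unfolding b_eq by linarith
  qed (use k1 k2 in \<open>auto simp: t_def\<close>)
  then show "(2 * k - 3) / 3 < db" by (simp add: t_def)
qed

lemma delta_star_ex1: "\<exists>!d. db < d \<and> d < 1 \<and> yf k d = -1"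
proof -
  have "\<exists>d. db \<le> d \<and> d \<le> 1 \<and> zf k d = k - 1"
    using delta_b k1 k2 
    by (intro IVT') (auto simp: b_eq intro: continuous_on_subset[OF zf_continuous])
  then obtain d where d: "db \<le> d" "d \<le> 1" "zf k d = k - 1" by blast
  have "d \<noteq> db" "d \<noteq> 1" using d delta_b k2 by (auto simp: b_eq)
  with d have "db < d \<and> d < 1 \<and> yf k d = -1" by (auto simp: yf_def)
  moreover have "d' = d" if "db < d' \<and> d' < 1 \<and> yf k d' = -1" for d'
    by (rule iffD1[OF zf_inject]) (use that d k1 delta_b in \<open>auto simp: yf_def\<close>)
  ultimately show ?thesis by (rule ex1I)
qed

lemma delta_star: "db < ds" "ds < 1" "yf k ds = -1"
  using theI'[OF delta_star_ex1] by (auto simp: delta_star_def)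

section \<open>The functions \<open>A\<close>, \<open>T\<close>, \<open>W\<close> and the parameter
  \<open>delta_0\<close>\<close>

lemma Af_deriv:
  assumes "t < k"
  shows "(Af k has_real_derivative yf k t) (at t)"
proof -
  have "(Af k has_real_derivative (2 - k) - t + 2 * k * (ln (k - 1) - ln (k - t))) (at t)"
  proof -
    have h: "((\<lambda>t. (k - t) * ln (k - t)) has_real_derivative - ln (k - t) - 1) (at t)"
      using assms by (auto intro!: derivative_eq_intros)
    then show ?thesis
      unfolding Af_def[abs_def]
      by - ((rule h derivative_eq_intros refl zero_neq_numeral[symmetric])+, simp add: algebra_simps)
  qed
  moreover have "yf k t = (2 - k) - t + 2 * k * (ln (k - 1) - ln (k - t))"
    using assms k1 by (simp add: yf_def zf_def ln_div)
  ultimately show ?thesis by simp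
qed

lemma Tf_deriv:
  assumes "t < k"
  shows "(Tf k has_real_derivative - yf k t - (1 + t) / 2) (at t)"
  unfolding Tf_def[abs_def] using assms 
  by (auto intro!: derivative_eq_intros Af_deriv simp: field_simps)

lemma Tf_1 [simp]: "Tf k 1 = 0"
  by (simp add: Tf_def)

text \<open>The link between \<open>W\<close> and \<open>T\<close>: where \<open>T \<le> 0\<close>
  the root is real, and at the zero \<open>delta_0\<close> of \<open>T\<close> it is the root of a
  perfect square, so that the left and middle pieces meet.\<close>

lemma Wsq_eq:
  assumes "t < k"
  shows "Wsq k t = ((t - 1) / 2 - b)\<^sup>2 - Tf k t"
proof -
  have l: "ln ((k - t) / (k - 1)) = ln (k - t) - ln (k - 1)"
    using assms k1 by (simp add: ln_div)
  show ?thesis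
    unfolding Wsq_def Tf_def Af_def b_eq l by (simp add: power2_eq_square) (simp add: algebra_simps add_divide_distrib diff_divide_distrib)
qed

text \<open>The equation \<open>zf k db = b\<close> eliminates the logarithm. The resulting
  \<open>W = db\<close> makes the middle piece end at \<open>x = b\<close> with
  \<open>U = b + db\<close>, where the right piece begins.\<close>

lemma Wsq_db: "Wsq k db = db\<^sup>2"
proof -
  have l: "2 * k * ln ((k - db) / (k - 1)) = 4 - k - db"
    using delta_b k1 by (simp add: zf_def b_eq ln_div algebra_simps)
  have "Wsq k db = b\<^sup>2 - 2 * b * (db - 1)
     + (k - db) * (2 * k * ln ((k - db) / (k - 1))) + 2 * k * (db - 1)"
    unfolding Wsq_def by (simp add: algebra_simps)
  also have "\<dots> = db\<^sup>2"
    unfolding l by (simp add: b_eq power2_eq_square algebra_simps)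
  finally show ?thesis .
qed

text \<open>By \<open>Wsq_eq\<close> and \<open>Wsq_db\<close> the value is a difference of two
  squares, and \<open>delta_b_lower\<close> gives the signs of its factors.\<close>

lemma Tf_db: "Tf k db < 0"
proof -
  have "Tf k db = ((db - 1) / 2 - b)\<^sup>2 - db\<^sup>2"
    using Wsq_eq[of db] Wsq_db delta_b k1 by simp
  also have "\<dots> = - ((b + (1 + db) / 2) * ((3 * db - 1) / 2 - b))"
    by (simp add: power2_eq_square field_simps)
  also have "\<dots> < 0"
  proof -
    have "0 < b + (1 + db) / 2" "0 < (3 * db - 1) / 2 - b"
      using delta_b_lower by (auto simp: b_eq field_simps)
    then show ?thesis using mult_pos_pos by (metis neg_less_0_iff_less)
  qed
  finally show ?thesis .
qed

lemma Tf_mvt: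
  assumes "s < t" "t \<le> 1"
  obtains x where "s < x" "x < t" "Tf k t - Tf k s = (t - s) * (- yf k x - (1 + x) / 2)"
  using MVT2[OF assms(1), of "Tf k" "\<lambda>x. - yf k x - (1 + x) / 2"] Tf_deriv assms k1
  by (auto)

text \<open>Strict concavity of \<open>T\<close> on \<open>[0, 1]\<close>. Together with
  \<open>T(1) = 0\<close> it determines the sign pattern of \<open>T\<close>.\<close>

lemma Tf_deriv_decreasing:
  assumes "0 \<le> s" "s < t" "t \<le> 1"
  shows "- yf k t - (1 + t) / 2 < - yf k s - (1 + s) / 2"
proof -
  have "zf k s < zf k t"
    using assms k1 by (intro zf_strict_mono) auto
  then show ?thesis using assms by (simp add: yf_def field_simps)
qed

text \<open>By Rolle between the zeros \<open>a\<close> and 1, the decreasing derivative is still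
  positive at \<open>a\<close>, so \<open>T\<close> increases up to \<open>a\<close>. Two different
  zeros below 1 are thereby impossible.\<close>

lemma Tf_before_zero:
  assumes "Tf k a = 0" "0 \<le> a" "a < 1"
  shows "0 < - yf k a - (1 + a) / 2"
    and "\<And>s. 0 \<le> s \<Longrightarrow> s < a \<Longrightarrow> Tf k s < 0"
proof -
  obtain x where x: "a < x" "x < 1" "Tf k 1 - Tf k a = (1 - a) * (- yf k x - (1 + x) / 2)"
    using Tf_mvt[OF assms(3)] by auto
  then show *: "0 < - yf k a - (1 + a) / 2"
  proof -
    have "(1 - a) * (- yf k x - (1 + x) / 2) = 0" using x(3) assms by simp
    then have "- yf k x - (1 + x) / 2 = 0" using assms by (metis diff_eq_diff_eq diff_gt_0_iff_gt less_irrefl mult_eq_0_iff)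
    then show ?thesis using Tf_deriv_decreasing[of a x] x assms by linarith
  qed
  fix s assume s: "0 \<le> s" "s < a"
  obtain x where x: "s < x" "x < a" "Tf k a - Tf k s = (a - s) * (- yf k x - (1 + x) / 2)"
    using Tf_mvt[OF s(2)] assms by auto
  have "0 < - yf k x - (1 + x) / 2"
    using Tf_deriv_decreasing[of x a] x s assms * by linarith
  then have "0 < Tf k a - Tf k s"
    unfolding x(3) using s by (intro mult_pos_pos) auto
  then show "Tf k s < 0" using assms by simp
qed

lemma delta_0_ex1: "\<exists>!d. db < d \<and> d < 1 \<and> Tf k d = 0"
proof -
  \<comment> \<open>The slope of \<open>T\<close> at its trivial zero 1 is \<open>k - 2 < 0\<close>,
    so \<open>T\<close> is positive just to the left of 1, and the intermediate value theorem yields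
    a zero that is strictly smaller.\<close>
  have "- yf k 1 - (1 + 1) / 2 < 0" using k2 by (simp add: yf_1)
  from DERIV_neg_dec_left[OF Tf_deriv this] k1
  obtain e where e: "0 < e" "\<And>h. 0 < h \<Longrightarrow> h < e \<Longrightarrow> Tf k 1 < Tf k (1 - h)" by auto
  define h where "h = min (e / 2) ((1 - db) / 2)"
  have h: "0 < h" "h < e" "db < 1 - h" using e delta_b by (auto simp: h_def min_def field_simps)
  have "continuous_on {db..1 - h} (Tf k)"
    by (rule DERIV_continuous_on[where D = "\<lambda>t. - yf k t - (1 + t) / 2"])
       (rule has_field_derivative_at_within[OF Tf_deriv], use h k1 in auto)
  then have "\<exists>d. db \<le> d \<and> d \<le> 1 - h \<and> Tf k d = 0"
    using Tf_db h e(2)[of h] by (intro IVT') auto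
  then obtain d where d: "db \<le> d" "d \<le> 1 - h" "Tf k d = 0" by blast
  have "d \<noteq> db" using d Tf_db by auto
  with d h have "db < d \<and> d < 1 \<and> Tf k d = 0" by auto
  moreover have "d = d'" if "db < d \<and> d < 1 \<and> Tf k d = 0" "db < d' \<and> d' < 1 \<and> Tf k d' = 0" for d d'
    using Tf_before_zero(2)[of d d'] Tf_before_zero(2)[of d' d] that delta_b
    by (cases d d' rule: linorder_cases) auto
  ultimately show ?thesis by blast
qed

lemma delta_0: "db < d0" "d0 < 1" "Tf k d0 = 0"
  using theI'[OF delta_0_ex1] by (auto simp: delta_0_def)

lemma Tf_neg: "db \<le> t \<Longrightarrow> t < d0 \<Longrightarrow> Tf k t < 0"
  using Tf_before_zero(2)[OF delta_0(3)] delta_0 delta_b by auto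

text \<open>\<open>T\<close> is strictly concave and vanishes at \<open>d0\<close> and at 1. A
  nonpositive value in between would force a mean slope \<open>\<le> 0\<close> before it and one
  \<open>\<ge> 0\<close> after it.\<close>

lemma Tf_pos:
  assumes "d0 < t" "t < 1"
  shows "0 < Tf k t"
proof -
  obtain x where x: "d0 < x" "x < t" "Tf k t - Tf k d0 = (t - d0) * (- yf k x - (1 + x) / 2)"
    using Tf_mvt[OF assms(1)] assms by auto
  obtain x' where x': "t < x'" "x' < 1" "Tf k 1 - Tf k t = (1 - t) * (- yf k x' - (1 + x') / 2)"
    using Tf_mvt[OF assms(2)] assms by auto
  have lt: "- yf k x' - (1 + x') / 2 < - yf k x - (1 + x) / 2"
    using Tf_deriv_decreasing[of x x'] x x' delta_0 delta_b by auto
  show ?thesis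
  proof (rule ccontr)
    assume "\<not> ?thesis"
    then have "(t - d0) * (- yf k x - (1 + x) / 2) \<le> 0" 
      "0 \<le> (1 - t) * (- yf k x' - (1 + x') / 2)"
      unfolding x(3)[symmetric] x'(3)[symmetric] using delta_0 by auto
    then have "- yf k x - (1 + x) / 2 \<le> 0" "0 \<le> - yf k x' - (1 + x') / 2"
      using assms by (auto simp: mult_le_0_iff zero_le_mult_iff)
    then show False using lt by linarith
  qed
qed

text \<open>At this point the square in \<open>Wsq_eq\<close> vanishes, so the claim amounts to
  \<open>Wsq > 0\<close>, which the rational bound for \<open>ln\<close> at
  \<open>(1 - b) / (1 + b)\<close> settles.\<close>

lemma Tf_neg_2k_minus_3: "Tf k (2 * k - 3) < 0"
proof -
  have nb: "- 1 < b" "b < 0" using k1 k2 by (auto simp: b_eq)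
  let ?r = "(1 - b) / (1 + b)"
  have "2 * (?r - 1) / (?r + 1) = - 2 * b"
    using nb by (simp add: field_simps)
  then have l: "- 2 * b \<le> ln ?r"
    using ln_ge_rational[of ?r] nb by simp
  have e: "k - (2 * k - 3) = 1 - b" "k - 1 = 1 + b" "2 * k - 3 - 1 = 2 * b" by (auto simp: b_eq)
  have "Wsq k (2 * k - 3) = - 3 * b\<^sup>2 + 2 * k * ((1 - b) * ln ?r + 2 * b)"
    unfolding Wsq_def e add_diff_eq[symmetric] by (simp add: power2_eq_square)
  also have "\<dots> \<ge> - 3 * b\<^sup>2 + 2 * k * ((1 - b) * (- 2 * b) + 2 * b)"
    using l nb k1 by (intro add_left_mono mult_left_mono add_right_mono) auto
  also have "- 3 * b\<^sup>2 + 2 * k * ((1 - b) * (- 2 * b) + 2 * b) = b\<^sup>2 * (4 * k - 3)"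
    by algebra
  finally have le: "b\<^sup>2 * (4 * k - 3) \<le> Wsq k (2 * k - 3)" .
  have "0 < b\<^sup>2 * (4 * k - 3)"
    using nb k1 by (intro mult_pos_pos) auto
  with le have "0 < Wsq k (2 * k - 3)" by linarith
  then show ?thesis
    using Wsq_eq[of "2 * k - 3"] k2 by (simp add: b_eq field_simps)
qed

text \<open>Decides the sign of the square root in \<open>Wf k d0 = (d0 - 1) / 2 - b\<close>.\<close>

lemma delta_0_lower: "2 * k - 3 < d0"
  using Tf_pos[of "2 * k - 3"] Tf_neg_2k_minus_3 delta_0 k2
  by (cases d0 "2 * k - 3" rule: linorder_cases) auto

subsection \<open>The equations in the extended parameter\<close>

text \<open>The parameter \<open>\<delta>\<close> is continued past \<open>1\<close> in such a way that \<open>rbar k y dy = d\<delta> / 4\<close> under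
  \<open>y = ext_y \<delta>\<close> on the whole interval from \<open>-2\<close> to \<open>eta_b k\<close>; \<open>ext_A\<close> is a primitive of \<open>ext_y\<close>.\<close>

definition ext_y :: "real \<Rightarrow> real" where
  "ext_y t = (if t \<le> 1 then zf k t else t) - k"

definition ext_A :: "real \<Rightarrow> real" where
  "ext_A t = (if t \<le> 1 then Af k t else Af k 1 + ((t - k)\<^sup>2 - (1 - k)\<^sup>2) / 2)"

text \<open>At \<open>x = -1\<close> the two equations only say \<open>L = R\<close>; the last conjunct selects \<open>ds\<close>.\<close>

definition ext_sol :: "real \<Rightarrow> real \<Rightarrow> real \<Rightarrow> bool" where
  "ext_sol x L R \<longleftrightarrow> db \<le> L \<and> R - L = 2 * (x + 1) \<and> ext_A R - ext_A L = x\<^sup>2 - 1 \<and> (x = -1 \<longrightarrow> ext_y L = -1)"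

text \<open>With \<open>s = 2 * (x + 1)\<close> the term \<open>s\<^sup>2 / 4 - s\<close> is \<open>x\<^sup>2 - 1\<close>, so the zeros of \<open>excess\<close> are the
  solutions.  It is strictly convex in \<open>s\<close>, because \<open>ext_y\<close> has slope at least \<open>1\<close>, and strictly
  increasing in \<open>L\<close>.\<close>

definition excess :: "real \<Rightarrow> real \<Rightarrow> real" where
  "excess L s = ext_A (L + s) - ext_A L - s\<^sup>2 / 4 + s"

section \<open>Monotonicity and the primitive of the extended coordinate\<close>

lemma ext_y_le: "t \<le> 1 \<Longrightarrow> ext_y t = yf k t"
  by (simp add: ext_y_def yf_def)

lemma ext_y_ge: "1 \<le> t \<Longrightarrow> ext_y t = t - k"
  by (auto simp: ext_y_def)

lemma ext_A_le: "t \<le> 1 \<Longrightarrow> ext_A t = Af k t"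
  by (simp add: ext_A_def)

lemma ext_A_ge: "1 \<le> t \<Longrightarrow> ext_A t = Af k 1 + ((t - k)\<^sup>2 - (1 - k)\<^sup>2) / 2"
  by (cases "t = 1") (auto simp: ext_A_def)

lemma ext_y_db: "ext_y db = -2"
  using delta_b by (simp add: ext_y_le yf_db)

lemma ext_y_ds: "ext_y ds = -1"
  using delta_star by (simp add: ext_y_le)

lemma ext_y_expanding:
  assumes "0 \<le> s" "s \<le> t"
  shows "t - s \<le> ext_y t - ext_y s"
proof -
  consider "t \<le> 1" | "s \<le> 1" "1 \<le> t" | "1 \<le> s" using assms by linarith
  then show ?thesis
  proof cases
    case 1
    then show ?thesis using zf_expanding[of s t] assms k1 by (simp add: ext_y_def)
  next
    case 2
    then show ?thesis using zf_expanding[of s 1] assms k1 by (auto simp: ext_y_ge ext_y_le yf_def)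
  next
    case 3
    then show ?thesis using assms by (simp add: ext_y_ge)
  qed
qed

lemma ext_y_strict_mono: "0 \<le> s \<Longrightarrow> s < t \<Longrightarrow> ext_y s < ext_y t"
  using ext_y_expanding[of s t] by simp

lemma ext_y_mono: "0 \<le> s \<Longrightarrow> s \<le> t \<Longrightarrow> ext_y s \<le> ext_y t"
  using ext_y_expanding[of s t] by simp

lemma ext_y_less_iff: "0 \<le> s \<Longrightarrow> 0 \<le> t \<Longrightarrow> ext_y s < ext_y t \<longleftrightarrow> s < t"
  using ext_y_strict_mono[of s t] ext_y_mono[of t s] by linarith

lemma ext_y_inject: "0 \<le> s \<Longrightarrow> 0 \<le> t \<Longrightarrow> ext_y s = ext_y t \<longleftrightarrow> s = t"
  using ext_y_strict_mono[of s t] ext_y_strict_mono[of t s] by (cases s t rule: linorder_cases) auto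

lemma ext_y_continuous: "continuous_on UNIV ext_y"
proof -
  \<comment> \<open>One formula for both branches: the clamped-off branch contributes its value 1 at
    the junction, which the \<open>- 1\<close> removes.\<close>
  have "continuous_on UNIV (\<lambda>t. zf k (min t 1) + max t 1 - 1 - k)"
    using k1 by (intro continuous_intros continuous_on_compose2[OF zf_continuous]) auto
  moreover have "(\<lambda>t. zf k (min t 1) + max t 1 - 1 - k) = ext_y"
    by (auto simp: ext_y_def min_def max_def)
  ultimately show ?thesis by metis
qed

text \<open>The branches share the value \<open>Af k 1\<close> and the slope \<open>1 - k\<close> at
  1, so they glue differentiably.\<close>

lemma ext_A_deriv: "(ext_A has_real_derivative ext_y t) (at t)"
proof -
  have "((\<lambda>x. if x \<in> {..1} then Af k x else Af k 1 + ((x - k)\<^sup>2 - (1 - k)\<^sup>2) / 2)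
      has_vector_derivative (if t \<in> {..1} then yf k t else t - k)) (at t within UNIV)"
  proof (rule has_vector_derivative_If_within_closures[where T = "{1..}"])
    show "(Af k has_vector_derivative yf k t) (at t within {..1} \<union> closure {..1} \<inter> closure {1..})"
      if "t \<in> {..1} \<union> closure {..1} \<inter> closure {1..}"
    proof -
      have "t < k" using that k1 by auto
      then show ?thesis
        unfolding has_real_derivative_iff_has_vector_derivative[symmetric]
        by (rule has_field_derivative_at_within[OF Af_deriv])
    qed
    show "((\<lambda>x. Af k 1 + ((x - k)\<^sup>2 - (1 - k)\<^sup>2) / 2) has_vector_derivative t - k)
      (at t within {1..} \<union> closure {..1} \<inter> closure {1..})"
      unfolding has_real_derivative_iff_has_vector_derivative[symmetric]
      by (auto intro!: derivative_eq_intros)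
  qed (auto simp: yf_1)
  moreover have "(\<lambda>x. if x \<in> {..1} then Af k x else Af k 1 + ((x - k)\<^sup>2 - (1 - k)\<^sup>2) / 2) = ext_A"
    by (auto simp: ext_A_def)
  moreover have "(if t \<in> {..1} then yf k t else t - k) = ext_y t"
    by (auto simp: ext_y_def yf_def)
  ultimately show ?thesis
    by (simp add: has_real_derivative_iff_has_vector_derivative)
qed

lemma ext_A_shift_deriv: "((\<lambda>s. ext_A (s + c)) has_real_derivative ext_y (x + c)) (at x)"
  using ext_A_deriv[of "x + c"] by (simp add: DERIV_shift)

lemma ext_A_mvt:
  assumes "s < t"
  obtains x where "s < x" "x < t" "ext_A t - ext_A s = (t - s) * ext_y x"
  using MVT2[OF assms, of ext_A ext_y] ext_A_deriv by blast

lemma ext_A_bounds: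
  assumes "0 \<le> s" "s \<le> t"
  shows "(t - s) * ext_y s \<le> ext_A t - ext_A s" "ext_A t - ext_A s \<le> (t - s) * ext_y t"
proof -
  have "(t - s) * ext_y s \<le> ext_A t - ext_A s \<and> ext_A t - ext_A s \<le> (t - s) * ext_y t"
  proof (cases "s = t")
    case False
    then have "s < t" using assms by simp
    then obtain x where "s < x" "x < t" "ext_A t - ext_A s = (t - s) * ext_y x" by (rule ext_A_mvt)
    then show ?thesis using assms ext_y_mono[of s x] ext_y_mono[of x t] by (auto intro!: mult_left_mono)
  qed simp
  then show "(t - s) * ext_y s \<le> ext_A t - ext_A s" "ext_A t - ext_A s \<le> (t - s) * ext_y t" by auto
qed

section \<open>Convexity and monotonicity of the excess\<close>

lemma excess_mvt:
  assumes "s < t"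
  obtains x where "s < x" "x < t" "excess L t - excess L s = (t - s) * (ext_y (L + x) - x / 2 + 1)"
proof -
  have "((\<lambda>s. ext_A (L + s)) has_real_derivative ext_y (L + x)) (at x)" for x
    using ext_A_shift_deriv[of L x] by (simp add: add.commute)
  then have "(excess L has_real_derivative ext_y (L + x) - x / 2 + 1) (at x)" for x
    unfolding excess_def[abs_def] by (auto intro!: derivative_eq_intros)
  then show thesis
    using MVT2[OF assms, of "excess L" "\<lambda>x. ext_y (L + x) - x / 2 + 1"] that by blast
qed

lemma excess_0 [simp]: "excess L 0 = 0"
  by (simp add: excess_def)

lemma excess_slope_mono:
  assumes "0 \<le> L" "0 \<le> s" "s < t"
  shows "ext_y (L + s) - s / 2 + 1 < ext_y (L + t) - t / 2 + 1"
  using ext_y_expanding[of "L + s" "L + t"] assms by (simp add: field_simps)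

text \<open>A strictly convex function vanishing at 0 that is nonnegative at some
  \<open>s > 0\<close> is positive beyond \<open>s\<close>; here in terms of mean slopes before and
  after \<open>s\<close>.\<close>

lemma excess_pos_later:
  assumes "0 \<le> L" "0 < s" "s < t" "0 \<le> excess L s"
  shows "0 < excess L t"
proof -
  obtain x where x: "0 < x" "x < s" "excess L s - excess L 0 = (s - 0) * (ext_y (L + x) - x / 2 + 1)"
    using assms(2) by (rule excess_mvt)
  obtain y where y: "s < y" "y < t" "excess L t - excess L s = (t - s) * (ext_y (L + y) - y / 2 + 1)"
    using assms(3) by (rule excess_mvt)
  have "0 \<le> ext_y (L + x) - x / 2 + 1"
    using x(3) assms by (simp add: zero_le_mult_iff)
  also have "\<dots> < ext_y (L + y) - y / 2 + 1"
    using x y assms by (intro excess_slope_mono) auto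
  finally have "0 < (t - s) * (ext_y (L + y) - y / 2 + 1)"
    using assms by (intro mult_pos_pos) auto
  then show ?thesis using y(3) assms by linarith
qed

text \<open>The derivative in \<open>L\<close> is \<open>ext_y (L + s) - ext_y L\<close>, which is
  positive.\<close>

lemma excess_strict_mono:
  assumes "0 \<le> L" "L < L'" "0 < s"
  shows "excess L s < excess L' s"
proof -
  have d: "((\<lambda>l. ext_A (l + s) - ext_A l) has_real_derivative ext_y (l + s) - ext_y l) (at l)" for l
    by (intro DERIV_diff ext_A_shift_deriv ext_A_deriv)
  have "ext_A (L + s) - ext_A L < ext_A (L' + s) - ext_A L'"
  proof (rule DERIV_pos_imp_increasing[OF assms(2)])
    fix l assume "L \<le> l" "l \<le> L'"
    then show "\<exists>y. ((\<lambda>l. ext_A (l + s) - ext_A l) has_real_derivative y) (at l) \<and> 0 < y"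
      using d[of l] ext_y_strict_mono[of l "l + s"] assms by auto
  qed
  then show ?thesis by (simp add: excess_def)
qed

lemma excess_eq: "excess L (2 * (x + 1)) = ext_A (L + 2 * (x + 1)) - ext_A L - (x\<^sup>2 - 1)"
  by (simp add: excess_def power2_eq_square field_simps)

section \<open>Solutions: position, uniqueness and dependence on \<open>x\<close>\<close>

lemma ext_sol_iff_excess:
  "ext_sol x L R \<longleftrightarrow> db \<le> L \<and> R = L + 2 * (x + 1) \<and> excess L (2 * (x + 1)) = 0 \<and> (x = -1 \<longrightarrow> ext_y L = -1)"
  unfolding ext_sol_def excess_eq by (auto simp: algebra_simps)

lemma ext_solD:
  assumes "ext_sol x L R"
  shows "db \<le> L" "R = L + 2 * (x + 1)" "0 < L"
  using assms delta_b by (auto simp: ext_sol_iff_excess)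

lemma ext_sol_minus_1: "ext_sol (-1) L R \<longleftrightarrow> L = ds \<and> R = ds"
  using delta_star delta_b ext_y_inject[of L ds] by (auto simp: ext_sol_iff_excess ext_y_ds)

text \<open>Rolle: the excess vanishes at 0 and at \<open>2 * (x + 1)\<close>, so its increasing
  slope is negative at 0 and positive at the end. These two slopes are \<open>ext_y L + 1\<close>
  and \<open>ext_y R - x\<close>.\<close>

lemma ext_sol_order_strict:
  assumes "ext_sol x L R" "-1 < x"
  shows "ext_y L < -1" "x < ext_y R"
proof -
  have "0 < 2 * (x + 1)" using assms by simp
  then obtain s where s: "0 < s" "s < 2 * (x + 1)"
    "excess L (2 * (x + 1)) - excess L 0 = (2 * (x + 1) - 0) * (ext_y (L + s) - s / 2 + 1)"
    by (rule excess_mvt)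
  then have "ext_y (L + s) - s / 2 + 1 = 0"
    using assms by (auto simp: ext_sol_iff_excess)
  then show "ext_y L < -1" "x < ext_y R"
    using excess_slope_mono[of L 0 s] excess_slope_mono[of L s "2 * (x + 1)"] ext_solD[OF assms(1)] s
    by (auto simp: field_simps)
qed

lemma ext_sol_order:
  assumes "ext_sol x L R" "-1 \<le> x"
  shows "ext_y L \<le> -1" "x \<le> ext_y R"
  using ext_sol_order_strict[of x L R] assms by (cases "x = -1"; force simp: ext_sol_minus_1 ext_y_ds)+

lemma ext_sol_unique:
  assumes "ext_sol x L R" "ext_sol x L' R'" "-1 \<le> x"
  shows "L = L'" "R = R'"
proof -
  show "L = L'"
  proof (cases "x = -1")
    case True
    then show ?thesis using assms by (simp add: ext_sol_minus_1)
  next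
    case False
    then show ?thesis
      using excess_strict_mono[of L L' "2 * (x + 1)"] excess_strict_mono[of L' L "2 * (x + 1)"] assms
        ext_solD(3)[OF assms(1)] ext_solD(3)[OF assms(2)]
      by (cases L L' rule: linorder_cases) (auto simp: ext_sol_iff_excess)
  qed
  then show "R = R'" using ext_solD(2)[OF assms(1)] ext_solD(2)[OF assms(2)] by simp
qed

text \<open>For fixed \<open>L\<close> the excess is positive past its zero, and a larger
  \<open>L\<close> increases it further, so \<open>L'\<close> must lie below \<open>L\<close>. If
  \<open>R' \<le> R\<close> held, the bounds \<open>ext_y L \<le> -1\<close> and
  \<open>x' \<le> ext_y R'\<close> in the moment equations would give
  \<open>(x' - x) * (x + x' + 2) \<le> 0\<close>.\<close>

lemma ext_sol_mono:
  assumes "ext_sol x L R" "ext_sol x' L' R'" "-1 \<le> x" "x < x'"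
  shows "L' < L" "R < R'"
proof -
  have L: "0 < L" "0 < L'" using assms ext_solD by auto
  show L'_less: "L' < L"
  proof (cases "x = -1")
    case True
    then have "ext_y L' < ext_y L" using assms ext_sol_order_strict[of x' L' R'] by (simp add: ext_sol_minus_1 ext_y_ds)
    then show ?thesis using L by (simp add: ext_y_less_iff)
  next
    case False
    have "0 < excess L (2 * (x' + 1))"
      using excess_pos_later[of L "2 * (x + 1)" "2 * (x' + 1)"] assms False L
      by (auto simp: ext_sol_iff_excess)
    moreover have "excess L' (2 * (x' + 1)) = 0" using assms by (simp add: ext_sol_iff_excess)
    ultimately show ?thesis
      using excess_strict_mono[of L L' "2 * (x' + 1)"] L assms by (cases L L' rule: linorder_cases) auto
  qed
  show "R < R'"
  proof (rule ccontr)
    assume "\<not> R < R'"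
    then have R: "R' \<le> R" by simp
    have "0 \<le> R'" using ext_solD[OF assms(2)] assms L by simp
    then have "(R - R') * x' \<le> (R - R') * ext_y R'"
      using R assms ext_sol_order[of x' L' R'] by (intro mult_left_mono) auto
    also have "\<dots> \<le> ext_A R - ext_A R'" using ext_A_bounds R \<open>0 \<le> R'\<close> by simp
    finally have 1: "(R - R') * x' \<le> ext_A R - ext_A R'" .
    have "ext_A L - ext_A L' \<le> (L - L') * ext_y L" using ext_A_bounds L'_less L by simp
    also have "\<dots> \<le> (L - L') * (-1)"
      using L'_less assms ext_sol_order[of x L R] by (intro mult_left_mono) auto
    finally have 2: "ext_A L - ext_A L' \<le> - (L - L')" by simp
    have "x'\<^sup>2 - x\<^sup>2 = (ext_A L - ext_A L') - (ext_A R - ext_A R')"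
      using assms by (simp add: ext_sol_def)
    also have "\<dots> \<le> - (L - L') - (R - R') * x'" using 1 2 by simp
    also have "\<dots> = - 2 * (x' - x) - (R - R') * (1 + x')"
      using ext_solD(2)[OF assms(1)] ext_solD(2)[OF assms(2)] by (simp add: algebra_simps)
    also have "\<dots> \<le> - 2 * (x' - x)" using R assms by simp
    finally have "(x' - x) * (x + x' + 2) \<le> 0" by (simp add: power2_eq_square algebra_simps)
    moreover have "0 < (x' - x) * (x + x' + 2)" using assms by (intro mult_pos_pos) auto
    ultimately show False by linarith
  qed
qed

text \<open>\<open>R - L\<close> changes by exactly \<open>2 * (x' - x)\<close>, and
  \<open>R\<close> and \<open>-L\<close> both increase, so neither can change by more.\<close>

lemma ext_sol_lipschitz:
  assumes "ext_sol x L R" "ext_sol x' L' R'" "-1 \<le> x" "-1 \<le> x'"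
  shows "\<bar>L - L'\<bar> \<le> 2 * \<bar>x - x'\<bar>" "\<bar>R - R'\<bar> \<le> 2 * \<bar>x - x'\<bar>"
proof -
  note d = ext_solD(2)[OF assms(1)] ext_solD(2)[OF assms(2)]
  have "\<bar>L - L'\<bar> \<le> 2 * \<bar>x - x'\<bar> \<and> \<bar>R - R'\<bar> \<le> 2 * \<bar>x - x'\<bar>"
  proof (cases x x' rule: linorder_cases)
    case less
    then show ?thesis using ext_sol_mono[OF assms(1,2) assms(3)] d by auto
  next
    case equal
    then show ?thesis using ext_sol_unique[of x L R L' R'] assms by auto
  next
    case greater
    then show ?thesis using ext_sol_mono[OF assms(2,1) assms(4)] d by auto
  qed
  then show "\<bar>L - L'\<bar> \<le> 2 * \<bar>x - x'\<bar>" "\<bar>R - R'\<bar> \<le> 2 * \<bar>x - x'\<bar>" by auto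
qed

section \<open>Existence of solutions on the left and middle pieces\<close>

lemma LR_iff_ext_sol:
  assumes "-1 < x"
  shows "LR_solution k x L R \<longleftrightarrow> ext_sol x L R \<and> R \<le> 1"
proof -
  have "L \<le> 1" if "R \<le> 1" "R - L = 2 * (x + 1)" using that assms by simp
  then show ?thesis
    using assms by (auto simp: LR_solution_def ext_sol_def ext_A_le)
qed

text \<open>Zeros of \<open>T\<close> below 1 thus correspond to solutions with
  \<open>R = 1\<close>; this is what singles out \<open>delta_0\<close> and
  \<open>x0\<close>.\<close>

lemma excess_to_1: "t \<le> 1 \<Longrightarrow> excess t (1 - t) = Tf k t"
  by (simp add: excess_def Tf_def ext_A_le power2_eq_square field_simps)

lemma x0_bounds: "-1 < x0 k" "x0 k < b"
  using delta_0 delta_b_lower by (auto simp: x0_def b_eq field_simps)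

lemma b_bounds: "-1 < b" "b < 0"
  using k1 k2 by (auto simp: b_eq)

lemma x0_shift: "2 * (x0 k + 1) = 1 - d0"
  by (simp add: x0_def field_simps)

lemma ext_sol_x0: "ext_sol (x0 k) d0 1"
  unfolding ext_sol_iff_excess x0_shift using excess_to_1[of d0] delta_0 x0_bounds by simp

text \<open>Intermediate values in \<open>L\<close> for fixed \<open>h = R - L\<close>: the excess
  is nonpositive at \<open>L = db\<close>, and at \<open>L = 1 - h\<close>, that is at
  \<open>R = 1\<close>, it equals \<open>Tf k (1 - h) \<ge> 0\<close>.\<close>

lemma left_ext_sol_ex:
  assumes "-1 < x" "x \<le> x0 k"
  obtains L R where "ext_sol x L R" "R \<le> 1"
proof -
  define h where "h = 2 * (x + 1)"
  have h: "0 < h" "h \<le> 1 - d0" using assms x0_shift by (auto simp: h_def)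
  \<comment> \<open>Compare with \<open>excess d0 (1 - d0) = Tf k d0 = 0\<close>. By
    \<open>excess_pos_later\<close> the negative value at \<open>1 - d0\<close> excludes positive
    values at smaller \<open>h\<close>.\<close>
  have neg: "excess db (1 - d0) < 0"
    using excess_strict_mono[of db d0 "1 - d0"] excess_to_1[of d0] delta_0 delta_b by auto
  have "excess db h \<le> 0"
    using excess_pos_later[of db h "1 - d0"] neg h delta_b
    by (cases "h = 1 - d0"; cases "0 \<le> excess db h") auto
  moreover have "0 \<le> excess (1 - h) h"
  proof (cases "1 - h = d0")
    case True
    then have h_eq: "h = 1 - d0" by simp
    show ?thesis using excess_to_1[of d0] delta_0 unfolding h_eq by simp
  next
    case False
    then show ?thesis using excess_to_1[of "1 - h"] Tf_pos[of "1 - h"] h by auto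
  qed
  moreover have "continuous_on {db..1 - h} (\<lambda>L. excess L h)"
    unfolding excess_def
    by (rule DERIV_continuous_on, rule has_field_derivative_at_within)
       (rule derivative_eq_intros ext_A_shift_deriv ext_A_deriv refl zero_neq_numeral[symmetric])+
  ultimately have "\<exists>L. db \<le> L \<and> L \<le> 1 - h \<and> excess L h = 0"
    using h delta_0 by (intro IVT') auto
  then obtain L where "db \<le> L" "L \<le> 1 - h" "excess L h = 0" by blast
  then have "ext_sol x L (L + h)" "L + h \<le> 1"
    using assms by (auto simp: ext_sol_iff_excess h_def)
  then show thesis by (rule that)
qed

lemma Wsq_ge:
  assumes "db \<le> t" "t \<le> d0"
  shows "((t - 1) / 2 - b)\<^sup>2 \<le> Wsq k t"
  using Wsq_eq[of t] Tf_neg[of t] delta_0 assms k1 by (cases "t = d0") auto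

lemma Wf_sq:
  assumes "db \<le> t" "t \<le> d0"
  shows "(Wf k t)\<^sup>2 = ((t - 1) / 2 - b)\<^sup>2 - Tf k t"
proof -
  have "0 \<le> Wsq k t" using Wsq_ge[OF assms] by (rule order_trans[rotated]) simp
  then show ?thesis
    using Wsq_eq[of t] assms delta_0 k1 by (simp add: Wf_def)
qed

text \<open>Equivalent to \<open>R \<ge> 1\<close> for the \<open>R\<close> of the middle
  piece.\<close>

lemma Wf_ge:
  assumes "db \<le> t" "t \<le> d0"
  shows "(t - 1) / 2 - b \<le> Wf k t"
  unfolding Wf_def by (rule real_le_rsqrt[OF Wsq_ge[OF assms]])

lemma Wf_db: "Wf k db = db"
  using delta_b by (simp add: Wf_def Wsq_db)

lemma Wf_d0: "Wf k d0 = (d0 - 1) / 2 - b"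
proof -
  have "Wsq k d0 = ((d0 - 1) / 2 - b)\<^sup>2"
    using Wsq_eq[of d0] delta_0 k1 by simp
  moreover have "0 \<le> (d0 - 1) / 2 - b" using delta_0_lower by (simp add: b_eq)
  ultimately show ?thesis by (simp add: Wf_def)
qed

lemma mid_source_db: "mid_source k db = b"
  by (simp add: mid_source_def Wf_db)

lemma mid_source_d0: "mid_source k d0 = x0 k"
  by (simp add: mid_source_def Wf_d0 x0_def field_simps)

text \<open>For \<open>R \<ge> 1\<close> the primitive \<open>ext_A\<close> is quadratic at
  \<open>R\<close>, so with \<open>L = t\<close> given the moment equation is quadratic in
  \<open>x\<close>. \<open>mid_source k t\<close> is its larger root, with \<open>W\<close> the
  square root of the discriminant.\<close>

lemma mid_ext_sol:
  assumes "db \<le> t" "t \<le> d0"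
  defines "R \<equiv> b - t + 2 * Wf k t + k"
  shows "1 \<le> R" "-1 < mid_source k t" "ext_sol (mid_source k t) t R"
proof -
  show R1: "1 \<le> R" using Wf_ge[OF assms(1,2)] by (simp add: R_def b_eq field_simps)
  have shift: "R - t = 2 * (mid_source k t + 1)"
    by (simp add: R_def mid_source_def b_eq)
  then show less: "-1 < mid_source k t" using R1 assms(2) delta_0(2) by argo
  have A: "Af k 1 - Af k t = ((t - 1) / 2 - b)\<^sup>2 - (Wf k t)\<^sup>2 + (1 + t)\<^sup>2 / 4 - 1"
    unfolding Wf_sq[OF assms(1,2)] by (simp add: Tf_def)
  have "ext_A R - ext_A t = Af k 1 - Af k t + ((R - k)\<^sup>2 - (1 - k)\<^sup>2) / 2"
    using R1 assms(2) delta_0 by (simp add: ext_A_ge ext_A_le)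
  also have "\<dots> = (mid_source k t)\<^sup>2 - 1"
    unfolding A by (simp add: R_def mid_source_def b_eq power2_eq_square field_simps)
  finally show "ext_sol (mid_source k t) t R"
    using shift less assms(1) by (simp add: ext_sol_def)
qed

text \<open>Injective because \<open>x\<close> determines the parameter \<open>t = L\<close>. The
  range stays between the endpoint values because \<open>L\<close> decreases in \<open>x\<close>,
  and continuity fills it.\<close>

lemma mid_source_bij: "bij_betw (mid_source k) {db..d0} {x0 k..b}"
proof (rule bij_betw_imageI)
  show "inj_on (mid_source k) {db..d0}"
  proof (rule inj_onI)
    fix s t assume "s \<in> {db..d0}" "t \<in> {db..d0}" "mid_source k s = mid_source k t"
    then show "s = t"
      using mid_ext_sol(2)[of s] mid_ext_sol(3)[of s] mid_ext_sol(3)[of t] by (auto intro: ext_sol_unique(1))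
  qed
  show "mid_source k ` {db..d0} = {x0 k..b}"
  proof (intro equalityI subsetI)
    fix x assume "x \<in> mid_source k ` {db..d0}"
    then obtain t where t: "db \<le> t" "t \<le> d0" "x = mid_source k t" by auto
    note s = mid_ext_sol[OF t(1,2), folded t(3)]
    have "ext_sol b db (b - db + 2 * Wf k db + k)"
      using mid_ext_sol(3)[of db] delta_0 by (simp add: mid_source_db)
    from ext_sol_mono(1)[OF this s(3)] b_bounds t have "\<not> b < x" by force
    moreover have "\<not> x < x0 k"
      using ext_sol_mono(1)[OF s(3) ext_sol_x0] s t by force
    ultimately show "x \<in> {x0 k..b}" by simp
  next
    fix x assume x: "x \<in> {x0 k..b}"
    have "continuous_on {db..d0} (Wsq k)"
      unfolding Wsq_def using k1 delta_0 by (intro continuous_intros) auto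
    then have "continuous_on {db..d0} (mid_source k)"
      unfolding mid_source_def Wf_def by (intro continuous_intros)
    then have "\<exists>t. db \<le> t \<and> t \<le> d0 \<and> mid_source k t = x"
      using x delta_0 by (intro IVT2') (auto simp: mid_source_db mid_source_d0)
    then show "x \<in> mid_source k ` {db..d0}" by force
  qed
qed

lemma ext_sol_ex:
  assumes "-1 \<le> x" "x \<le> b"
  shows "\<exists>L R. ext_sol x L R"
proof -
  consider "x = -1" | "-1 < x" "x \<le> x0 k" | "x \<in> {x0 k..b}" using assms by fastforce
  then show ?thesis
  proof cases
    case 1
    then show ?thesis using ext_sol_minus_1 by blast
  next
    case 2
    then show ?thesis using left_ext_sol_ex by blast
  next
    case 3
    then obtain t where "t \<in> {db..d0}" "x = mid_source k t"
      using mid_source_bij by (metis bij_betw_imp_surj_on imageE)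
    then show ?thesis using mid_ext_sol(3)[of t] by auto
  qed
qed

section \<open>The solution as a pair of functions of \<open>x\<close>\<close>

definition low :: "real \<Rightarrow> real" where
  "low x = (SOME L. \<exists>R. ext_sol x L R)"

text \<open>Defined through the mass equation, so that \<open>high x - low x = 2 * (x + 1)\<close>
  holds for every real \<open>x\<close>; \<open>low_deriv\<close> reads the derivative of
  \<open>low\<close> off this identity.\<close>

definition high :: "real \<Rightarrow> real" where
  "high x = low x + 2 * (x + 1)"

lemma ext_sol_low_high: "-1 \<le> x \<Longrightarrow> x \<le> b \<Longrightarrow> ext_sol x (low x) (high x)"
  unfolding high_def low_def using someI_ex[OF ext_sol_ex] ext_solD(2) by metis

lemma low_high_eq: "ext_sol x L R \<Longrightarrow> -1 \<le> x \<Longrightarrow> x \<le> b \<Longrightarrow> low x = L \<and> high x = R"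
  using ext_sol_unique[OF ext_sol_low_high] by blast

lemma low_high_minus_1: "low (-1) = ds" "high (-1) = ds"
  using low_high_eq[of "-1" ds ds] b_bounds ext_sol_minus_1 by auto

lemma low_high_b: "low b = db" "high b = db + 2 * (b + 1)"
proof -
  have "ext_sol b db (b - db + 2 * Wf k db + k)"
    using mid_ext_sol(3)[of db] delta_0 by (simp add: mid_source_db)
  from low_high_eq[OF this] b_bounds show "low b = db" by auto
  then show "high b = db + 2 * (b + 1)" by (simp add: high_def)
qed

lemma low_high_left:
  assumes "-1 \<le> x" "x \<le> x0 k"
  shows "high x \<le> 1"
proof -
  have "ext_sol (x0 k) (low (x0 k)) (high (x0 k))" using x0_bounds by (intro ext_sol_low_high) auto
  moreover have "high (x0 k) = 1" using low_high_eq[OF ext_sol_x0] x0_bounds by auto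
  ultimately show ?thesis
    using ext_sol_mono(2)[OF ext_sol_low_high[of x]] assms x0_bounds by (cases "x = x0 k") force+
qed

lemma LR_iff_low_high:
  assumes "-1 < x" "x \<le> x0 k"
  shows "LR_solution k x L R \<longleftrightarrow> L = low x \<and> R = high x"
proof -
  have "x \<le> b" using assms x0_bounds by simp
  with assms show ?thesis
    using LR_iff_ext_sol[OF assms(1)] low_high_eq[of x L R] ext_sol_low_high[of x] low_high_left[of x] by auto
qed

lemma Lf_Rf:
  assumes "-1 \<le> x" "x \<le> x0 k"
  shows "Lf k x = low x" "Rf k x = high x"
proof -
  have "Lf k x = low x \<and> Rf k x = high x"
  proof (cases "x = -1")
    case True
    then show ?thesis by (simp add: Lf_def Rf_def low_high_minus_1)
  next
    case False
    with assms have "(THE (L, R). LR_solution k x L R) = (low x, high x)"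
      by (intro the_equality) (auto simp: LR_iff_low_high)
    then show ?thesis using False by (simp add: Lf_def Rf_def)
  qed
  then show "Lf k x = low x" "Rf k x = high x" by auto
qed

lemma low_high_lipschitz:
  assumes "-1 \<le> x" "x \<le> b" "-1 \<le> x'" "x' \<le> b"
  shows "\<bar>low x - low x'\<bar> \<le> 2 * \<bar>x - x'\<bar>" "\<bar>high x - high x'\<bar> \<le> 2 * \<bar>x - x'\<bar>"
  using ext_sol_lipschitz[OF ext_sol_low_high[of x] ext_sol_low_high[of x']] assms by auto

lemma low_high_continuous: "continuous_on {-1..b} low" "continuous_on {-1..b} high"
proof -
  have "2-lipschitz_on {-1..b} low" "2-lipschitz_on {-1..b} high"
    using low_high_lipschitz by (auto intro!: lipschitz_onI simp: dist_real_def)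
  then show "continuous_on {-1..b} low" "continuous_on {-1..b} high"
    by (auto intro: lipschitz_on_continuous_on)
qed

text \<open>The Lipschitz bound reaches \<open>x = -1\<close>, where the extra conjunct of
  \<open>ext_sol\<close> has fixed the value \<open>ds\<close>.\<close>

lemma Lf_Rf_tendsto: "(Lf k \<longlongrightarrow> ds) (at_right (-1))" "(Rf k \<longlongrightarrow> ds) (at_right (-1))"
proof -
  have "(low \<longlongrightarrow> low (-1)) (at_right (-1))" "(high \<longlongrightarrow> high (-1)) (at_right (-1))"
    using low_high_continuous b_bounds by (auto simp: continuous_on_Icc_at_rightD)
  moreover have ev: "\<forall>\<^sub>F x in at_right (-1). x \<in> {-1<..<x0 k}"
    using x0_bounds by (intro eventually_at_rightI) auto
  moreover have "\<forall>\<^sub>F x in at_right (-1). low x = Lf k x" "\<forall>\<^sub>F x in at_right (-1). high x = Rf k x"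
    using ev by (auto elim!: eventually_mono simp: Lf_Rf)
  ultimately show "(Lf k \<longlongrightarrow> ds) (at_right (-1))" "(Rf k \<longlongrightarrow> ds) (at_right (-1))"
    by (auto simp: low_high_minus_1 elim: Lim_transform_eventually)
qed

subsection \<open>The residual density and the glued maps\<close>

lemma zf_bij: "bij_betw (zf k) {db..1} {b..1}"
proof (rule bij_betw_imageI)
  show "inj_on (zf k) {db..1}"
    using delta_b k1 by (intro inj_onI) (auto simp: zf_inject)
  show "zf k ` {db..1} = {b..1}"
  proof (intro equalityI subsetI)
    fix x assume "x \<in> zf k ` {db..1}"
    then obtain t where t: "db \<le> t" "t \<le> 1" "x = zf k t" by auto
    then show "x \<in> {b..1}"
      using zf_expanding[of db t] zf_expanding[of t 1] delta_b k1 by auto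
  next
    fix x assume x: "x \<in> {b..1}"
    have "continuous_on {db..1} (zf k)"
      using k1 by (intro continuous_on_subset[OF zf_continuous]) auto
    then have "\<exists>t. db \<le> t \<and> t \<le> 1 \<and> zf k t = x"
      using x delta_b by (intro IVT') auto
    then show "x \<in> zf k ` {db..1}" by force
  qed
qed

text \<open>Left and middle pieces merge into one formula: on the left \<open>R \<le> 1\<close>,
  where \<open>ext_y\<close> is \<open>yf k\<close>, and in the middle \<open>R \<ge> 1\<close>,
  where \<open>ext_y R = R - k\<close>.\<close>

lemma glued_maps_eq:
  assumes "glued_maps k D U" "-1 \<le> x" "x \<le> b"
  shows "D x = ext_y (low x)" "U x = ext_y (high x)"
proof -
  have "D x = ext_y (low x) \<and> U x = ext_y (high x)"
  proof (cases "x \<le> x0 k")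
    case True
    have "high x \<le> 1" "low x \<le> 1" using low_high_left[of x] True assms by (auto simp: high_def)
    then show ?thesis
      using assms True by (simp add: glued_maps_def left_piece_def Lf_Rf ext_y_le)
  next
    case False
    then obtain t where t: "t \<in> {db..d0}" "x = mid_source k t"
      using mid_source_bij assms by (metis atLeastAtMost_iff bij_betw_imp_surj_on imageE linorder_linear)
    note s = mid_ext_sol[of t, folded t(2)]
    have "low x = t" "high x = b - t + 2 * Wf k t + k"
      using low_high_eq[OF s(3)] t(1) assms by auto
    then show ?thesis
      using s t assms(1) delta_0 by (auto simp: glued_maps_def mid_piece_def ext_y_le ext_y_ge yf_def)
  qed
  then show "D x = ext_y (low x)" "U x = ext_y (high x)" by auto
qed

section \<open>Inverse coordinates and the residual density\<close>

definition inv_z :: "real \<Rightarrow> real" where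
  "inv_z = the_inv_into {db..1} (zf k)"

text \<open>The inverse of \<open>ext_y\<close> on parameters from \<open>db\<close> on. A quarter
  of it is a primitive of \<open>rbar k\<close> between \<open>-2\<close> and
  \<open>eta_b k\<close>.\<close>

definition inv_y :: "real \<Rightarrow> real" where
  "inv_y y = (if y \<le> 1 - k then inv_z (y + k) else y + k)"

lemma inv_z_zf: "db \<le> t \<Longrightarrow> t \<le> 1 \<Longrightarrow> inv_z (zf k t) = t"
  unfolding inv_z_def using zf_bij by (intro the_inv_into_f_f) (auto simp: bij_betw_def)

lemma zf_inv_z:
  assumes "b \<le> x" "x \<le> 1"
  shows "zf k (inv_z x) = x" "db \<le> inv_z x" "inv_z x \<le> 1"
proof -
  have "x \<in> zf k ` {db..1}" using assms zf_bij by (auto simp: bij_betw_def)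
  then obtain t where "db \<le> t" "t \<le> 1" "x = zf k t" by auto
  then show "zf k (inv_z x) = x" "db \<le> inv_z x" "inv_z x \<le> 1" by (auto simp: inv_z_zf)
qed

lemma inv_z_b: "inv_z b = db" and inv_z_1: "inv_z 1 = 1"
  using inv_z_zf[of db] inv_z_zf[of 1] delta_b by auto

lemma inv_z_diff:
  assumes "b \<le> x" "x \<le> x'" "x' \<le> 1"
  shows "inv_z x \<le> inv_z x'" "inv_z x' - inv_z x \<le> x' - x"
proof -
  note g = zf_inv_z[of x] zf_inv_z[of x']
  show le: "inv_z x \<le> inv_z x'"
  proof (rule ccontr)
    assume "\<not> ?thesis"
    then have "zf k (inv_z x') < zf k (inv_z x)"
      using g assms delta_b k1 by (intro zf_strict_mono) auto
    then show False using g assms by auto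
  qed
  show "inv_z x' - inv_z x \<le> x' - x"
    using zf_expanding[of "inv_z x" "inv_z x'"] le g assms delta_b k1 by auto
qed

lemma inv_z_continuous: "continuous_on {b..1} inv_z"
proof -
  have "\<bar>inv_z x - inv_z y\<bar> \<le> \<bar>x - y\<bar>" if "x \<in> {b..1}" "y \<in> {b..1}" for x y
    using inv_z_diff[of x y] inv_z_diff[of y x] that by (cases "x \<le> y") auto
  then have "1-lipschitz_on {b..1} inv_z"
    by (auto intro!: lipschitz_onI simp: dist_real_def)
  then show ?thesis by (rule lipschitz_on_continuous_on)
qed

lemma inv_z_deriv:
  assumes "b < x" "x < 1"
  shows "(inv_z has_real_derivative (k - inv_z x) / (k + inv_z x)) (at x)"
proof -
  note g = zf_inv_z[of x]
  have "(inv_z has_real_derivative inverse ((k + inv_z x) / (k - inv_z x))) (at x)"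
  proof (rule DERIV_inverse_function[where f = "zf k"])
    show "(zf k has_real_derivative (k + inv_z x) / (k - inv_z x)) (at (inv_z x))"
      using g assms k1 by (intro zf_deriv) auto
    show "(k + inv_z x) / (k - inv_z x) \<noteq> 0" using g assms k1 delta_b by auto
    show "isCont inv_z x" 
      using inv_z_continuous assms
      by (intro continuous_on_interior[of "{b..1}"]) auto
  qed (use assms in \<open>auto intro: zf_inv_z\<close>)
  then show ?thesis by simp
qed

lemma ext_y_upper: "db \<le> t \<Longrightarrow> t \<le> 1 \<Longrightarrow> ext_y t \<le> 1 - k"
  using ext_y_mono[of t 1] delta_b by (simp add: ext_y_ge)

lemma inv_y_ext_y: "db \<le> t \<Longrightarrow> inv_y (ext_y t) = t"
  using ext_y_upper[of t] inv_z_zf[of t] by (auto simp: inv_y_def ext_y_def)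

lemma ext_y_inv_y:
  assumes "-2 \<le> y"
  shows "ext_y (inv_y y) = y" "db \<le> inv_y y"
proof -
  have "ext_y (inv_y y) = y \<and> db \<le> inv_y y"
  proof (cases "y \<le> 1 - k")
    case True
    then show ?thesis using zf_inv_z[of "y + k"] assms by (auto simp: inv_y_def ext_y_def b_eq)
  next
    case False
    then show ?thesis using delta_b by (auto simp: inv_y_def ext_y_def)
  qed
  then show "ext_y (inv_y y) = y" "db \<le> inv_y y" by auto
qed

text \<open>The inverse of an expanding map does not expand. The second bound says that
  \<open>y - inv_y y\<close> is nondecreasing, so the mass sent down from \<open>[b, 1]\<close> is
  nonnegative.\<close>

lemma inv_y_diff:
  assumes "-2 \<le> y" "y \<le> y'"
  shows "inv_y y \<le> inv_y y'" "inv_y y' - inv_y y \<le> y' - y"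
proof -
  note g = ext_y_inv_y[of y] ext_y_inv_y[of y']
  show le: "inv_y y \<le> inv_y y'"
  proof (rule ccontr)
    assume "\<not> ?thesis"
    then have "ext_y (inv_y y') < ext_y (inv_y y)"
      using g assms delta_b by (intro ext_y_strict_mono) auto
    then show False using g assms by auto
  qed
  show "inv_y y' - inv_y y \<le> y' - y"
    using ext_y_expanding[of "inv_y y" "inv_y y'"] le g assms delta_b by auto
qed

lemma inv_y_continuous: "continuous_on {-2..} inv_y"
proof -
  have "\<bar>inv_y x - inv_y y\<bar> \<le> \<bar>x - y\<bar>" if "x \<in> {-2..}" "y \<in> {-2..}" for x y
    using inv_y_diff[of x y] inv_y_diff[of y x] that by (cases "x \<le> y") auto
  then have "1-lipschitz_on {-2..} inv_y"
    by (auto intro!: lipschitz_onI simp: dist_real_def)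
  then show ?thesis by (rule lipschitz_on_continuous_on)
qed

text \<open>\<open>db + 2 * (b + 1)\<close> is the value of \<open>R\<close> at
  \<open>x = b\<close>.\<close>

lemma eta_b_eq: "eta_b k = ext_y (db + 2 * (b + 1))"
  using delta_b_lower by (simp add: eta_b_def b_eq ext_y_ge)

lemma eta_b_bounds: "1 - k < eta_b k" "eta_b k < 2"
  using delta_b_lower delta_b k1 k2 by (auto simp: eta_b_def b_eq)

text \<open>With \<open>p = \<delta> / (k + \<delta>)\<close> the number \<open>1 - 2 * p\<close> is
  \<open>(k - \<delta>) / (k + \<delta>)\<close>, the reciprocal slope of \<open>z\<close>. At
  \<open>1 - k\<close> the one-sided slopes differ.\<close>

lemma inv_y_deriv:
  assumes "-2 < y" "y < eta_b k" "y \<noteq> 1 - k"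
  shows "(inv_y has_real_derivative 4 * rbar k y) (at y)"
proof (cases "y < 1 - k")
  case True
  have "((\<lambda>y. inv_z (y + k)) has_real_derivative (k - inv_z (y + k)) / (k + inv_z (y + k))) (at y)"
    using inv_z_deriv[of "y + k"] True assms by (simp add: DERIV_shift b_eq)
  moreover have "(k - inv_z (y + k)) / (k + inv_z (y + k)) = 4 * rbar k y"
    using True assms zf_inv_z[of "y + k"] delta_b k1
    by (simp add: rbar_def down_weight_def Let_def inv_z_def[symmetric] b_eq field_simps)
  ultimately have "((\<lambda>y. inv_z (y + k)) has_real_derivative 4 * rbar k y) (at y)" by simp
  then show ?thesis
    by (rule has_field_derivative_transform_within_open[where S = "{..<1 - k}"])
       (use True in \<open>auto simp: inv_y_def\<close>)
next
  case False
  have "((\<lambda>y. y + k) has_real_derivative 4 * rbar k y) (at y)"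
    using False assms by (auto simp: rbar_def intro!: derivative_eq_intros)
  then show ?thesis
    by (rule has_field_derivative_transform_within_open[where S = "{1 - k<..}"])
       (use False assms in \<open>auto simp: inv_y_def\<close>)
qed

lemma rbar_has_integral:
  assumes "-2 \<le> u" "u \<le> v" "v \<le> eta_b k"
  shows "(rbar k has_integral (inv_y v - inv_y u) / 4) {u..v}"
    and "((\<lambda>y. y * rbar k y) has_integral (ext_A (inv_y v) - ext_A (inv_y u)) / 4) {u..v}"
proof -
  have cont: "continuous_on {u..v} inv_y"
    using assms by (intro continuous_on_subset[OF inv_y_continuous]) auto
  have "(rbar k has_integral (inv_y v / 4 - inv_y u / 4)) {u..v}"
  \<comment> \<open>The kink of \<open>inv_y\<close> at \<open>1 - k\<close> is the exceptional
    point.\<close>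
  proof (rule fundamental_theorem_of_calculus_interior_strong[of "{1 - k}"])
    fix y assume "y \<in> {u<..<v} - {1 - k}"
    then have "((\<lambda>y. inv_y y / 4) has_real_derivative rbar k y) (at y)"
      using assms by (auto intro!: derivative_eq_intros inv_y_deriv)
    then show "((\<lambda>y. inv_y y / 4) has_vector_derivative rbar k y) (at y)"
      by (simp add: has_real_derivative_iff_has_vector_derivative)
  qed (use assms cont in \<open>auto intro!: continuous_intros\<close>)
  then show "(rbar k has_integral (inv_y v - inv_y u) / 4) {u..v}"
    by (simp add: diff_divide_distrib)
  have "continuous_on UNIV ext_A"
    by (rule DERIV_continuous_on, rule has_field_derivative_at_within, rule ext_A_deriv)
  then have cont': "continuous_on {u..v} (\<lambda>y. ext_A (inv_y y))"
    by (rule continuous_on_compose2[OF _ cont]) simp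
  have "((\<lambda>y. y * rbar k y) has_integral (ext_A (inv_y v) / 4 - ext_A (inv_y u) / 4)) {u..v}"
  proof (rule fundamental_theorem_of_calculus_interior_strong[of "{1 - k}"])
    fix y assume y: "y \<in> {u<..<v} - {1 - k}"
    then have "(inv_y has_real_derivative 4 * rbar k y) (at y)"
      using assms by (intro inv_y_deriv) auto
    from DERIV_chain2[OF ext_A_deriv this]
    have "((\<lambda>y. ext_A (inv_y y)) has_real_derivative y * (4 * rbar k y)) (at y)"
      using ext_y_inv_y[of y] y assms by simp
    from DERIV_cdivide[OF this, of 4]
    have "((\<lambda>y. ext_A (inv_y y) / 4) has_real_derivative y * rbar k y) (at y)" by simp
    then show "((\<lambda>y. ext_A (inv_y y) / 4) has_vector_derivative y * rbar k y) (at y)"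
      by (simp add: has_real_derivative_iff_has_vector_derivative)
  qed (use assms cont' in \<open>auto intro!: continuous_intros\<close>)
  then show "((\<lambda>y. y * rbar k y) has_integral (ext_A (inv_y v) - ext_A (inv_y u)) / 4) {u..v}"
    by (simp add: diff_divide_distrib)
qed

text \<open>Substituting \<open>y = ext_y \<delta>\<close> turns mass and moment of
  \<open>rbar k\<close> into the increments of \<open>\<delta> / 4\<close> and
  \<open>ext_A / 4\<close>.\<close>

lemma integral_rbar_iff_ext_sol:
  assumes "-2 \<le> d" "d \<le> x" "x \<le> u" "u \<le> eta_b k"
  shows "integral {d..u} (rbar k) = (x + 1) / 2 \<and> integral {d..u} (\<lambda>y. y * rbar k y) = (x\<^sup>2 - 1) / 4
    \<longleftrightarrow> ext_sol x (inv_y d) (inv_y u)"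
proof -
  have "d \<le> u" using assms by simp
  note int = rbar_has_integral[OF assms(1) this assms(4)]
  note e = integral_unique[OF int(1)] integral_unique[OF int(2)]
  have *: "p / 4 = (x + 1) / 2 \<longleftrightarrow> p = 2 * (x + 1)" "p / 4 = (x\<^sup>2 - 1) / 4 \<longleftrightarrow> p = x\<^sup>2 - 1" for p
    by (auto simp: field_simps)
  \<comment> \<open>At \<open>x = -1\<close> the zero mass forces \<open>d = u\<close>, and
    \<open>d \<le> -1 \<le> u\<close> then fixes the common value.\<close>
  have "ext_y (inv_y d) = -1" if "inv_y u - inv_y d = 2 * (x + 1)" "x = -1"
  proof -
    have "inv_y u = inv_y d" using that by simp
    have "-2 \<le> u" using assms by linarith
    then have "u = ext_y (inv_y d)" using ext_y_inv_y(1)[of u] \<open>inv_y u = inv_y d\<close> by metis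
    moreover have d: "ext_y (inv_y d) = d" using assms(1) by (rule ext_y_inv_y)
    ultimately have "d = -1" using that(2) assms(2,3) by linarith
    with d show ?thesis by metis
  qed
  moreover have "db \<le> inv_y d" using ext_y_inv_y(2)[of d] assms by simp
  ultimately show ?thesis
    unfolding e ext_sol_def * by blast
qed

lemma low_mono: "-1 \<le> x \<Longrightarrow> x \<le> x' \<Longrightarrow> x' \<le> b \<Longrightarrow> low x' \<le> low x"
  using ext_sol_mono(1)[OF ext_sol_low_high[of x] ext_sol_low_high[of x']] by (cases "x = x'") auto

lemma high_mono: "-1 \<le> x \<Longrightarrow> x \<le> x' \<Longrightarrow> x' \<le> b \<Longrightarrow> high x \<le> high x'"
  using ext_sol_mono(2)[OF ext_sol_low_high[of x] ext_sol_low_high[of x']] by (cases "x = x'") auto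

lemma low_high_bounds:
  assumes "-1 \<le> x" "x \<le> b"
  shows "db \<le> low x" "low x \<le> ds" "ds \<le> high x" "high x \<le> db + 2 * (b + 1)"
  using low_mono[of "-1" x] low_mono[of x b] high_mono[of "-1" x] high_mono[of x b] assms
  by (auto simp: low_high_minus_1 low_high_b)

lemma ext_y_low_high_bounds:
  assumes "-1 \<le> x" "x \<le> b"
  shows "-2 \<le> ext_y (low x)" "ext_y (low x) \<le> -1" "-1 \<le> ext_y (low x) \<Longrightarrow> x = -1" "x \<le> ext_y (high x)" "ext_y (high x) \<le> eta_b k"
proof -
  note bd = low_high_bounds[OF assms]
  show "-2 \<le> ext_y (low x)" "ext_y (high x) \<le> eta_b k"
    using ext_y_mono[of db "low x"] ext_y_mono[of "high x" "db + 2 * (b + 1)"] bd delta_b delta_star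
    by (auto simp: ext_y_db eta_b_eq)
  show "ext_y (low x) \<le> -1" "x \<le> ext_y (high x)"
    using ext_sol_order[OF ext_sol_low_high[OF assms]] assms by auto
  show "x = -1" if "-1 \<le> ext_y (low x)"
    using ext_sol_order_strict(1)[OF ext_sol_low_high[OF assms]] assms that by force
qed

section \<open>Existence and uniqueness of the maps\<close>

lemma glued_maps_monotone:
  assumes "glued_maps k D U"
  shows "monotone_construction k D U"
proof -
  note eq = glued_maps_eq[OF assms]
  have "antimono_on {-1..b} D"
  proof (rule monotone_onI)
    fix x x' assume x: "x \<in> {-1..b}" "x' \<in> {-1..b}" "x \<le> x'"
    then show "D x' \<le> D x"
      using low_mono[of x x'] low_high_bounds[of x'] delta_b by (auto simp: eq intro!: ext_y_mono)
  qed
  moreover have "mono_on {-1..b} U"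
  proof (rule monotone_onI)
    fix x x' assume x: "x \<in> {-1..b}" "x' \<in> {-1..b}" "x \<le> x'"
    then show "U x \<le> U x'"
      using high_mono[of x x'] low_high_bounds[of x] delta_b delta_star by (auto simp: eq intro!: ext_y_mono)
  qed
  moreover have "\<forall>x\<in>{-1..b}. -2 \<le> D x \<and> D x \<le> x \<and> x \<le> U x \<and> U x \<le> eta_b k \<and>
      integral {D x..U x} (rbar k) = (x + 1) / 2 \<and>
      integral {D x..U x} (\<lambda>y. y * rbar k y) = (x\<^sup>2 - 1) / 4"
  proof
    fix x assume x: "x \<in> {-1..b}"
    have bd: "-2 \<le> D x" "D x \<le> x" "x \<le> U x" "U x \<le> eta_b k"
      using ext_y_low_high_bounds[of x] x by (auto simp: eq)
    moreover have "ext_sol x (inv_y (D x)) (inv_y (U x))"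
      using ext_sol_low_high[of x] low_high_bounds[of x] x delta_star by (simp add: eq inv_y_ext_y)
    ultimately show "-2 \<le> D x \<and> D x \<le> x \<and> x \<le> U x \<and> U x \<le> eta_b k \<and>
      integral {D x..U x} (rbar k) = (x + 1) / 2 \<and>
      integral {D x..U x} (\<lambda>y. y * rbar k y) = (x\<^sup>2 - 1) / 4"
      using integral_rbar_iff_ext_sol[OF bd] by simp
  qed
  moreover have "right_piece k D U" using assms by (simp add: glued_maps_def)
  ultimately show ?thesis
    unfolding monotone_construction_def by (intro conjI)
qed

text \<open>On \<open>[-1, b]\<close> both constructions solve the same equations in the coordinate
  \<open>inv_y\<close>, so \<open>ext_sol_unique\<close> applies at each \<open>x\<close>; on
  \<open>[b, 1]\<close> both are prescribed.\<close>

lemma monotone_construction_unique: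
  assumes "monotone_construction k D U" "monotone_construction k D' U'" "-1 \<le> x" "x \<le> 1"
  shows "D' x = D x \<and> U' x = U x"
proof (cases "x \<le> b")
  case True
  have s: "ext_sol x (inv_y (D x)) (inv_y (U x)) \<and> -2 \<le> D x \<and> -2 \<le> U x"
    if "monotone_construction k D U" for D U
  proof -
    have *: "-2 \<le> D x" "D x \<le> x" "x \<le> U x" "U x \<le> eta_b k"
      "integral {D x..U x} (rbar k) = (x + 1) / 2"
      "integral {D x..U x} (\<lambda>y. y * rbar k y) = (x\<^sup>2 - 1) / 4"
      using that True assms(3) by (auto simp: monotone_construction_def)
    then show ?thesis using integral_rbar_iff_ext_sol[OF *(1-4)] by auto
  qed
  from s[OF assms(1)] s[OF assms(2)] have "inv_y (D' x) = inv_y (D x)" "inv_y (U' x) = inv_y (U x)"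
    using ext_sol_unique assms(3) by blast+
  then show ?thesis
    using s[OF assms(1)] s[OF assms(2)] ext_y_inv_y(1) by metis
next
  case False
  then have "inv_z x \<in> {db..1}" "zf k (inv_z x) = x" using zf_inv_z[of x] assms by auto
  then show ?thesis
    using assms(1,2) unfolding monotone_construction_def right_piece_def by metis
qed

text \<open>At \<open>x0\<close> the pieces agree because both come from the unique solution; at
  \<open>b\<close> agreement with the right piece is a computation.\<close>

lemma glued_maps_ex: "\<exists>D U. glued_maps k D U"
proof (intro exI)
  define D where "D x = (if x \<le> b then ext_y (low x) else x - k)" for x
  define U where "U x = (if x \<le> b then ext_y (high x) else x + inv_z x)" for x
  have "left_piece k D U"
    unfolding left_piece_def
  proof
    fix x assume x: "x \<in> {-1..x0 k}"
    then have "high x \<le> 1" "low x \<le> 1" using low_high_left[of x] by (auto simp: high_def)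
    then show "D x = yf k (Lf k x) \<and> U x = yf k (Rf k x)"
      using x x0_bounds by (simp add: D_def U_def Lf_Rf ext_y_le)
  qed
  moreover have "mid_piece k D U"
    unfolding mid_piece_def
  proof
    fix t assume t: "t \<in> {db..d0}"
    then have "mid_source k t \<in> {x0 k..b}" using mid_source_bij by (auto simp: bij_betw_def)
    then have le: "mid_source k t \<le> b" by simp
    note s = mid_ext_sol[of t]
    have "low (mid_source k t) = t" "high (mid_source k t) = b - t + 2 * Wf k t + k"
      using low_high_eq[OF s(3)] s(2) le t by auto
    then show "D (mid_source k t) = zf k t - k \<and> U (mid_source k t) = b - t + 2 * Wf k t"
      using le s(1) t delta_0 by (auto simp: D_def U_def ext_y_le ext_y_ge yf_def)
  qed
  moreover have "right_piece k D U"
    unfolding right_piece_def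
  proof
    fix t assume t: "t \<in> {db..1}"
    show "D (zf k t) = zf k t - k \<and> U (zf k t) = zf k t + t"
    \<comment> \<open>\<open>t = db\<close> is the shared point \<open>b\<close>, where
      \<open>D\<close> and \<open>U\<close> are defined by the solution branch.\<close>
    proof (cases "t = db")
      case True
      have "ext_y (high b) = b + db"
        unfolding low_high_b eta_b_eq[symmetric] eta_b_def ..
      then show ?thesis
        using True delta_b yf_db by (simp add: D_def U_def low_high_b(1) ext_y_db yf_def)
    next
      case False
      then have "b < zf k t" using t zf_strict_mono[of db t] delta_b k1 by auto
      then show ?thesis using t by (simp add: D_def U_def inv_z_zf)
    qed
  qed
  ultimately show "glued_maps k D U" by (simp add: glued_maps_def)
qed

subsection \<open>The second marginal\<close>

definition left_weight :: "real \<Rightarrow> real" where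
  "left_weight x = (x - ext_y (low x)) / (ext_y (high x) - ext_y (low x))"

lemma ext_y_low_less_high:
  assumes "-1 < x" "x \<le> b"
  shows "ext_y (low x) < x" "ext_y (low x) < ext_y (high x)"
  using ext_y_low_high_bounds[of x] assms by auto

text \<open>Subtract the equations \<open>ext_sol_def\<close> at \<open>x\<close> from those at \<open>z\<close>, write the increments of \<open>ext_A\<close>
  with Caratheodory difference quotients \<open>gL\<close> and \<open>gR\<close>, and eliminate \<open>low z - low x\<close>.\<close>

lemma high_deriv:
  assumes x: "-1 < x" "x < b"
  shows "(high has_real_derivative 2 * left_weight x) (at x)"
proof -
  obtain gL where gL: "\<And>z. ext_A z - ext_A (low x) = gL z * (z - low x)" "isCont gL (low x)" "gL (low x) = ext_y (low x)"
    using ext_A_deriv[of "low x"] unfolding CARAT_DERIV by blast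
  obtain gR where gR: "\<And>z. ext_A z - ext_A (high x) = gR z * (z - high x)" "isCont gR (high x)" "gR (high x) = ext_y (high x)"
    using ext_A_deriv[of "high x"] unfolding CARAT_DERIV by blast
  have "isCont low x" "isCont high x"
    using low_high_continuous x by (auto intro!: continuous_on_interior[of "{-1..b}"])
  then have "isCont (\<lambda>z. gL (low z)) x" "isCont (\<lambda>z. gR (high z)) x"
    using gL(2) gR(2) by (auto intro: isCont_o2)
  then have lim: "((\<lambda>z. gL (low z)) \<longlongrightarrow> ext_y (low x)) (at x)" "((\<lambda>z. gR (high z)) \<longlongrightarrow> ext_y (high x)) (at x)"
    by (auto simp: isCont_def gL(3) gR(3))
  have ne: "ext_y (high x) - ext_y (low x) \<noteq> 0" using ext_y_low_less_high[of x] x by simp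
  have "((\<lambda>z. (x + z - 2 * gL (low z)) / (gR (high z) - gL (low z))) \<longlongrightarrow>
      (x + x - 2 * ext_y (low x)) / (ext_y (high x) - ext_y (low x))) (at x)"
    using ne by (intro tendsto_intros lim) auto
  moreover have "(x + x - 2 * ext_y (low x)) / (ext_y (high x) - ext_y (low x)) = 2 * left_weight x"
    by (simp add: left_weight_def)
  ultimately have quot: "((\<lambda>z. (x + z - 2 * gL (low z)) / (gR (high z) - gL (low z))) \<longlongrightarrow> 2 * left_weight x) (at x)"
    by (simp only:)
  have "\<forall>\<^sub>F z in at x. (x + z - 2 * gL (low z)) / (gR (high z) - gL (low z)) = (high z - high x) / (z - x)"
  proof -
    have "\<forall>\<^sub>F z in at x. gR (high z) - gL (low z) \<noteq> 0"
      using tendsto_imp_eventually_ne[OF tendsto_diff[OF lim(2,1)] ne] .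
    moreover have "\<forall>\<^sub>F z in at x. z \<in> {-1<..<b}"
      using x by (intro eventually_at_in_open') auto
    moreover have "\<forall>\<^sub>F z in at x. z \<noteq> x"
      by (simp add: eventually_at_filter)
    ultimately show ?thesis
    proof eventually_elim
      case (elim z)
      have s: "ext_sol x (low x) (high x)" "ext_sol z (low z) (high z)" using x elim by (auto intro: ext_sol_low_high)
      have "gR (high z) * (high z - high x) - gL (low z) * (low z - low x) = z\<^sup>2 - x\<^sup>2"
        unfolding gL(1)[symmetric] gR(1)[symmetric] using s by (simp add: ext_sol_def)
      moreover have "low z - low x = high z - high x - 2 * (z - x)" by (simp add: high_def)
      ultimately have "(high z - high x) * (gR (high z) - gL (low z)) = (x + z - 2 * gL (low z)) * (z - x)"
        by (simp add: power2_eq_square algebra_simps)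
      then show ?case using elim by (simp add: frac_eq_eq)
    qed
  qed
  with quot show ?thesis
    unfolding has_field_derivative_iff by (rule Lim_transform_eventually)
qed

lemma low_deriv:
  assumes x: "-1 < x" "x < b"
  shows "(low has_real_derivative - 2 * (1 - left_weight x)) (at x)"
proof -
  have "low = (\<lambda>x. high x - 2 * (x + 1))" by (auto simp: high_def)
  then show ?thesis
    using high_deriv[OF x] by (auto intro!: derivative_eq_intros)
qed

text \<open>Versions of \<open>D\<close>, \<open>U\<close> and \<open>q\<close> that are Borel measurable on the whole line; outside \<open>[-1, 1]\<close>
  their values are irrelevant.\<close>

definition global_D :: "real \<Rightarrow> real" where
  "global_D x = indicator {-1..1} x *\<^sub>R (if x \<le> b then ext_y (low x) else x - k)"

definition global_U :: "real \<Rightarrow> real" where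
  "global_U x = indicator {-1..1} x *\<^sub>R (if x \<le> b then ext_y (high x) else x + inv_z x)"

definition global_q :: "real \<Rightarrow> real" where
  "global_q x = (if x \<in> {-1<..1} then (x - global_D x) / (global_U x - global_D x) else 1 / 2)"

section \<open>Properties of the Borel versions of the maps\<close>

lemma ext_y_high_b: "ext_y (high b) = b + db"
  unfolding low_high_b eta_b_eq[symmetric] eta_b_def ..

lemma ext_y_low_b: "ext_y (low b) = b - k"
  unfolding low_high_b ext_y_db by (simp add: b_eq)

lemma global_D_U_left:
  assumes "-1 \<le> x" "x \<le> b"
  shows "global_D x = ext_y (low x)" "global_U x = ext_y (high x)"
  using assms b_bounds by (auto simp: global_D_def global_U_def)

lemma global_D_U_right:
  assumes "b \<le> x" "x \<le> 1"
  shows "global_D x = x - k" "global_U x = x + inv_z x"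
  using assms b_bounds by (cases "x = b"; auto simp: global_D_def global_U_def ext_y_low_b ext_y_high_b inv_z_b)+

lemma global_q_left: "-1 < x \<Longrightarrow> x \<le> b \<Longrightarrow> global_q x = left_weight x"
  using b_bounds by (simp add: global_q_def left_weight_def global_D_U_left)

text \<open>Hence \<open>1 - global_q x\<close> is the lower weight \<open>p\<close> that enters
  \<open>rbar\<close>.\<close>

lemma global_q_right:
  assumes "b \<le> x" "x \<le> 1"
  shows "global_q x = k / (k + inv_z x)"
  using assms b_bounds by (simp add: global_q_def global_D_U_right add.commute)

lemma global_D_U_continuous:
  "continuous_on {-1..b} global_D" "continuous_on {-1..b} global_U" "continuous_on {b..1} global_D" "continuous_on {b..1} global_U"
proof -
  have "continuous_on {-1..b} global_D \<longleftrightarrow> continuous_on {-1..b} (\<lambda>x. ext_y (low x))"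
    "continuous_on {-1..b} global_U \<longleftrightarrow> continuous_on {-1..b} (\<lambda>x. ext_y (high x))"
    "continuous_on {b..1} global_D \<longleftrightarrow> continuous_on {b..1} (\<lambda>x. x - k)"
    "continuous_on {b..1} global_U \<longleftrightarrow> continuous_on {b..1} (\<lambda>x. x + inv_z x)"
    by (auto intro!: continuous_on_cong simp: global_D_U_left global_D_U_right)
  then show "continuous_on {-1..b} global_D" "continuous_on {-1..b} global_U" 
    "continuous_on {b..1} global_D" "continuous_on {b..1} global_U"
    using low_high_continuous inv_z_continuous
    by (auto intro!: continuous_intros continuous_on_compose2[OF ext_y_continuous])
qed

text \<open>The two continuous branches agree at \<open>b\<close>, so the maps are continuous on
  \<open>[-1, 1]\<close>; the indicator in their definitions cuts them off outside.\<close>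

lemma global_D_U_measurable [measurable]:
  "global_D \<in> borel_measurable borel" "global_U \<in> borel_measurable borel"
proof -
  have Icc: "{-1..1} = {-1..b} \<union> {b..1}" using b_bounds by auto
  have "continuous_on {-1..1} global_D" "continuous_on {-1..1} global_U"
    unfolding Icc by (intro continuous_on_closed_Un global_D_U_continuous closed_atLeastAtMost)+
  then have "(\<lambda>x. indicator {-1..1} x *\<^sub>R global_D x) \<in> borel_measurable borel" 
    "(\<lambda>x. indicator {-1..1} x *\<^sub>R global_U x) \<in> borel_measurable borel"
    by (auto intro: borel_measurable_continuous_on_indicator simp del: real_scaleR_def)
  moreover have "(\<lambda>x. indicator {-1..1} x *\<^sub>R global_D x) = global_D" "(\<lambda>x. indicator {-1..1} x *\<^sub>R global_U x) = global_U"
    by (auto simp: global_D_def global_U_def indicator_def)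
  ultimately show "global_D \<in> borel_measurable borel" "global_U \<in> borel_measurable borel" by auto
qed

lemma global_q_measurable [measurable]: "global_q \<in> borel_measurable borel"
  unfolding global_q_def[abs_def] by measurable

lemma global_D_U_order:
  assumes "-1 < x" "x \<le> 1"
  shows "global_D x < x" "x \<le> global_U x"
proof -
  have "global_D x < x \<and> x \<le> global_U x"
  proof (cases "x \<le> b")
    case True
    then show ?thesis using ext_y_low_less_high[of x] ext_y_low_high_bounds[of x] assms by (simp add: global_D_U_left)
  next
    case False
    then show ?thesis using zf_inv_z[of x] assms k1 delta_b by (simp add: global_D_U_right)
  qed
  then show "global_D x < x" "x \<le> global_U x" by auto
qed

lemma global_q_bounds: "0 \<le> global_q x" "global_q x \<le> 1"
  using global_D_U_order[of x] by (auto simp: global_q_def divide_simps)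

lemma global_q_mean: "-1 < x \<Longrightarrow> x \<le> 1 \<Longrightarrow> (1 - global_q x) * global_D x + global_q x * global_U x = x"
proof -
  assume x: "-1 < x" "x \<le> 1"
  then have "global_q x * (global_U x - global_D x) = x - global_D x"
    using global_D_U_order[of x] by (simp add: global_q_def)
  then show ?thesis by (simp add: algebra_simps)
qed

text \<open>On \<open>[-1, b]\<close> the barrier satisfies
  \<open>x - k \<le> b - k = -2 \<le> D\<close>; on \<open>[b, 1]\<close> the lower map lies on
  it.\<close>

lemma global_D_U_barrier:
  assumes "-1 \<le> x" "x \<le> 1"
  shows "x - k \<le> global_D x" "x - k \<le> global_U x"
proof -
  have "x - k \<le> global_D x \<and> x - k \<le> global_U x"
  proof (cases "x \<le> b")
    case True
    then show ?thesis
      using ext_y_low_high_bounds[of x] assms k1 by (simp add: global_D_U_left b_eq)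
  next
    case False
    then show ?thesis using zf_inv_z[of x] assms k1 delta_b by (simp add: global_D_U_right)
  qed
  then show "x - k \<le> global_D x" "x - k \<le> global_U x" by auto
qed

text \<open>\<open>R' = 2 * q\<close> and \<open>L' = -2 * (1 - q)\<close> make
  \<open>high / 4\<close> and \<open>- low / 4\<close> primitives; the factor \<open>1/2\<close> is
  the density of the source.\<close>

lemma weight_integrals_left:
  assumes "-1 \<le> x" "x \<le> x'" "x' \<le> b"
  shows "((\<lambda>x. global_q x / 2) has_integral (high x' - high x) / 4) {x..x'}"
    and "((\<lambda>x. (1 - global_q x) / 2) has_integral (low x - low x') / 4) {x..x'}"
proof -
  have "((\<lambda>x. global_q x / 2) has_integral (high x' / 4 - high x / 4)) {x..x'}"
  proof (rule fundamental_theorem_of_calculus_interior)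
    fix z assume "z \<in> {x<..<x'}"
    then have "((\<lambda>z. high z / 4) has_real_derivative global_q z / 2) (at z)"
      using assms DERIV_cdivide[OF high_deriv[of z], of 4] by (simp add: global_q_left)
    then show "((\<lambda>z. high z / 4) has_vector_derivative global_q z / 2) (at z)"
      by (simp add: has_real_derivative_iff_has_vector_derivative)
  qed (use assms in \<open>auto intro!: continuous_intros continuous_on_subset[OF low_high_continuous(2)]\<close>)
  then show "((\<lambda>x. global_q x / 2) has_integral (high x' - high x) / 4) {x..x'}"
    by (simp add: diff_divide_distrib)
  have "((\<lambda>x. (1 - global_q x) / 2) has_integral (low x' / (-4) - low x / (-4))) {x..x'}"
  proof (rule fundamental_theorem_of_calculus_interior)
    fix z assume "z \<in> {x<..<x'}"
    then have z: "-1 < z" "z < b" using assms by auto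
    have "((\<lambda>z. low z / (-4)) has_real_derivative (- 2 * (1 - left_weight z)) / (-4)) (at z)"
      by (intro DERIV_cdivide low_deriv z)
    moreover have "(- 2 * (1 - left_weight z)) / (-4) = (1 - global_q z) / 2"
      using z by (simp add: global_q_left field_simps)
    ultimately have "((\<lambda>z. low z / (-4)) has_real_derivative (1 - global_q z) / 2) (at z)"
      by (simp only:)
    then show "((\<lambda>z. low z / (-4)) has_vector_derivative (1 - global_q z) / 2) (at z)"
      by (simp add: has_real_derivative_iff_has_vector_derivative)
  qed (use assms in \<open>auto intro!: continuous_intros continuous_on_subset[OF low_high_continuous(1)]\<close>)
  then show "((\<lambda>x. (1 - global_q x) / 2) has_integral (low x - low x') / 4) {x..x'}"
    by (simp add: diff_divide_distrib)
qed

text \<open>With \<open>\<delta> = inv_z x\<close> the primitives are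
  \<open>(x + \<delta>) / 4\<close> and \<open>(x - \<delta>) / 4\<close>, because
  \<open>\<delta>' = (k - \<delta>) / (k + \<delta>)\<close> and
  \<open>q = k / (k + \<delta>)\<close>.\<close>

lemma weight_integrals_right:
  assumes "b \<le> x" "x \<le> x'" "x' \<le> 1"
  shows "((\<lambda>x. global_q x / 2) has_integral (x' + inv_z x' - (x + inv_z x)) / 4) {x..x'}"
    and "((\<lambda>x. (1 - global_q x) / 2) has_integral (x' - inv_z x' - (x - inv_z x)) / 4) {x..x'}"
proof -
  have *: "(1 + (k - inv_z z) / (k + inv_z z)) / 4 = global_q z / 2" "(1 - (k - inv_z z) / (k + inv_z z)) / 4 = (1 - global_q z) / 2"
    if "b \<le> z" "z \<le> 1" for z
  proof -
    have "k + inv_z z \<noteq> 0" using zf_inv_z[OF that] k1 delta_b by auto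
    then show "(1 + (k - inv_z z) / (k + inv_z z)) / 4 = global_q z / 2" "(1 - (k - inv_z z) / (k + inv_z z)) / 4 = (1 - global_q z) / 2"
      unfolding global_q_right[OF that] by (auto simp: divide_simps)
  qed
  have cont: "continuous_on {x..x'} inv_z"
    using assms by (intro continuous_on_subset[OF inv_z_continuous]) auto
  have "((\<lambda>x. global_q x / 2) has_integral ((x' + inv_z x') / 4 - (x + inv_z x) / 4)) {x..x'}"
  proof (rule fundamental_theorem_of_calculus_interior)
    fix z assume z: "z \<in> {x<..<x'}"
    then have "((\<lambda>z. (z + inv_z z) / 4) has_real_derivative (1 + (k - inv_z z) / (k + inv_z z)) / 4) (at z)"
      using assms by (intro DERIV_cdivide DERIV_add DERIV_ident inv_z_deriv) auto
    then have "((\<lambda>z. (z + inv_z z) / 4) has_real_derivative global_q z / 2) (at z)"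
      using z assms by (subst (asm) *) auto
    then show "((\<lambda>z. (z + inv_z z) / 4) has_vector_derivative global_q z / 2) (at z)"
      by (simp add: has_real_derivative_iff_has_vector_derivative)
  qed (use assms cont in \<open>auto intro!: continuous_intros\<close>)
  then show "((\<lambda>x. global_q x / 2) has_integral (x' + inv_z x' - (x + inv_z x)) / 4) {x..x'}"
    by (simp only: diff_divide_distrib)
  have "((\<lambda>x. (1 - global_q x) / 2) has_integral ((x' - inv_z x') / 4 - (x - inv_z x) / 4)) {x..x'}"
  proof (rule fundamental_theorem_of_calculus_interior)
    fix z assume z: "z \<in> {x<..<x'}"
    then have "((\<lambda>z. (z - inv_z z) / 4) has_real_derivative (1 - (k - inv_z z) / (k + inv_z z)) / 4) (at z)"
      using assms by (intro DERIV_cdivide DERIV_diff DERIV_ident inv_z_deriv) auto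
    then have "((\<lambda>z. (z - inv_z z) / 4) has_real_derivative (1 - global_q z) / 2) (at z)"
      using z assms by (subst (asm) *) auto
    then show "((\<lambda>z. (z - inv_z z) / 4) has_vector_derivative (1 - global_q z) / 2) (at z)"
      by (simp add: has_real_derivative_iff_has_vector_derivative)
  qed (use assms cont in \<open>auto intro!: continuous_intros\<close>)
  then show "((\<lambda>x. (1 - global_q x) / 2) has_integral (x' - inv_z x' - (x - inv_z x)) / 4) {x..x'}"
    by (simp only: diff_divide_distrib)
qed

section \<open>The four pieces of the image measure and their sum\<close>

lemma low_strict_antimono: "-1 \<le> x \<Longrightarrow> x < x' \<Longrightarrow> x' \<le> b \<Longrightarrow> low x' < low x"
  using ext_sol_mono(1)[OF ext_sol_low_high[of x] ext_sol_low_high[of x']] by auto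

lemma high_strict_mono: "-1 \<le> x \<Longrightarrow> x < x' \<Longrightarrow> x' \<le> b \<Longrightarrow> high x < high x'"
  using ext_sol_mono(2)[OF ext_sol_low_high[of x] ext_sol_low_high[of x']] by auto

lemma inv_y_values: "inv_y (-2) = db" "inv_y (-1) = ds" "1 - k \<le> y \<Longrightarrow> inv_y y = y + k"
  using inv_y_ext_y[of db] inv_y_ext_y[of ds] delta_star inv_z_1 by (auto simp: ext_y_db ext_y_ds inv_y_def)

lemma global_D_U_ends:
  "global_D (-1) = -1" "global_U (-1) = -1" "global_D b = -2" "global_U b = b + db" "global_D 1 = 1 - k" "global_U 1 = 2"
proof -
  show "global_D (-1) = -1" "global_U (-1) = -1" "global_D b = -2" "global_U b = b + db"
    using b_bounds by (simp_all add: global_D_U_left low_high_minus_1 ext_y_ds ext_y_high_b low_high_b(1) ext_y_db)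
  show "global_D 1 = 1 - k" "global_U 1 = 2"
    using b_bounds by (simp_all add: global_D_U_right inv_z_1)
qed

lemma weights_measurable:
  "(\<lambda>x. global_q x / 2) \<in> borel_measurable borel" "(\<lambda>x. (1 - global_q x) / 2) \<in> borel_measurable borel"
  by measurable

lemma weights_nonneg: "0 \<le> global_q x / 2" "0 \<le> (1 - global_q x) / 2"
  using global_q_bounds[of x] by auto

text \<open>\<open>inv_y\<close> carries \<open>global_D x\<close> back to \<open>low x\<close>, so
  the image has primitive \<open>inv_y / 4\<close>: the residual density on
  \<open>[-2, -1]\<close>.\<close>

lemma mass_left_D:
  "(\<integral>\<^sup>+x. ennreal ((1 - global_q x) / 2) * indicator {x\<in>{-1..b}. global_D x \<le> y} x \<partial>lborel)
    = ennreal (inv_y (max (-2) (min y (-1))) / 4 - db / 4)"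
proof -
  have "(\<integral>\<^sup>+x. ennreal ((1 - global_q x) / 2) * indicator {x\<in>{-1..b}. global_D x \<le> y} x \<partial>lborel)
    = ennreal (inv_y (max (global_D b) (min y (global_D (-1)))) / 4 - inv_y (global_D b) / 4)"
  proof (rule nn_integral_sublevel_decr[OF weights_measurable(2) weights_nonneg(2) _ global_D_U_continuous(1), where G = "\<lambda>y. inv_y y / 4"])
    show "global_D x' < global_D x" if "-1 \<le> x" "x < x'" "x' \<le> b" for x x'
      using that low_strict_antimono[of x x'] low_high_bounds[of x'] delta_b
      by (simp add: global_D_U_left ext_y_strict_mono)
    show "((\<lambda>x. (1 - global_q x) / 2) has_integral inv_y (global_D x) / 4 - inv_y (global_D b) / 4) {x..b}" if "x \<in> {-1..b}" for x
      using weight_integrals_left(2)[of x b] low_high_bounds[of x] low_high_bounds[of b] that b_bounds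
      by (simp add: global_D_U_left inv_y_ext_y diff_divide_distrib)
  qed (use b_bounds in auto)
  then show ?thesis by (simp add: global_D_U_ends inv_y_values)
qed

text \<open>Likewise with \<open>high x\<close>: the residual density on
  \<open>[-1, eta_b k]\<close>.\<close>

lemma mass_left_U:
  "(\<integral>\<^sup>+x. ennreal (global_q x / 2) * indicator {x\<in>{-1..b}. global_U x \<le> y} x \<partial>lborel)
    = ennreal (inv_y (max (-1) (min y (b + db))) / 4 - ds / 4)"
proof -
  have "(\<integral>\<^sup>+x. ennreal (global_q x / 2) * indicator {x\<in>{-1..b}. global_U x \<le> y} x \<partial>lborel)
    = ennreal (inv_y (max (global_U (-1)) (min y (global_U b))) / 4 - inv_y (global_U (-1)) / 4)"
  proof (rule nn_integral_sublevel_incr[OF weights_measurable(1) weights_nonneg(1) _ global_D_U_continuous(2), where G = "\<lambda>y. inv_y y / 4"])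
    show "strict_mono_on {-1..b} global_U"
    proof (rule strict_mono_onI)
      fix x x' assume "x \<in> {-1..b}" "x' \<in> {-1..b}" "x < x'"
      then show "global_U x < global_U x'"
        using high_strict_mono[of x x'] low_high_bounds[of x] delta_b delta_star
        by (simp add: global_D_U_left ext_y_strict_mono)
    qed
    show "((\<lambda>x. global_q x / 2) has_integral inv_y (global_U x) / 4 - inv_y (global_U (-1)) / 4) {-1..x}" if "x \<in> {-1..b}" for x
      using weight_integrals_left(1)[of "-1" x] low_high_bounds[of x] low_high_bounds[of "-1"] that b_bounds delta_star
      by (simp add: global_D_U_left inv_y_ext_y diff_divide_distrib)
  qed (use b_bounds in auto)
  then show ?thesis by (simp add: global_D_U_ends inv_y_values)
qed

text \<open>From \<open>y = x - k\<close> one has \<open>x = y + k\<close> and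
  \<open>inv_z x = inv_y y\<close>; the resulting density is \<open>1/4 - rbar k y\<close> on
  \<open>[-2, 1 - k]\<close>.\<close>

lemma mass_right_D:
  "(\<integral>\<^sup>+x. ennreal ((1 - global_q x) / 2) * indicator {x\<in>{b..1}. global_D x \<le> y} x \<partial>lborel)
    = ennreal ((max (-2) (min y (1 - k)) + k - inv_y (max (-2) (min y (1 - k)))) / 4 - (b - db) / 4)"
proof -
  have "(\<integral>\<^sup>+x. ennreal ((1 - global_q x) / 2) * indicator {x\<in>{b..1}. global_D x \<le> y} x \<partial>lborel)
    = ennreal ((max (global_D b) (min y (global_D 1)) + k - inv_y (max (global_D b) (min y (global_D 1)))) / 4
        - (global_D b + k - inv_y (global_D b)) / 4)"
  proof (rule nn_integral_sublevel_incr[OF weights_measurable(2) weights_nonneg(2) _ global_D_U_continuous(3), where G = "\<lambda>y. (y + k - inv_y y) / 4"])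
    show "strict_mono_on {b..1} global_D"
      by (rule strict_mono_onI) (simp add: global_D_U_right)
    show "((\<lambda>x. (1 - global_q x) / 2) has_integral (global_D x + k - inv_y (global_D x)) / 4 - (global_D b + k - inv_y (global_D b)) / 4) {b..x}"
      if "x \<in> {b..1}" for x
      using weight_integrals_right(2)[of b x] that b_bounds
      by (simp add: global_D_U_right inv_y_def diff_divide_distrib)
  qed (use b_bounds in auto)
  moreover have "-2 + k - inv_y (-2) = b - db" by (simp add: inv_y_values b_eq)
  ultimately show ?thesis by (simp only: global_D_U_ends(3,5))
qed

text \<open>Here \<open>U = x + inv_z x\<close> is itself four times the primitive, so the image has
  constant density \<open>1/4\<close> on \<open>[eta_b k, 2]\<close>.\<close>

lemma mass_right_U:
  "(\<integral>\<^sup>+x. ennreal (global_q x / 2) * indicator {x\<in>{b..1}. global_U x \<le> y} x \<partial>lborel)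
    = ennreal (max (b + db) (min y 2) / 4 - (b + db) / 4)"
proof -
  have "(\<integral>\<^sup>+x. ennreal (global_q x / 2) * indicator {x\<in>{b..1}. global_U x \<le> y} x \<partial>lborel)
    = ennreal (max (global_U b) (min y (global_U 1)) / 4 - global_U b / 4)"
  proof (rule nn_integral_sublevel_incr[OF weights_measurable(1) weights_nonneg(1) _ global_D_U_continuous(4), where G = "\<lambda>y. y / 4"])
    show "strict_mono_on {b..1} global_U"
    proof (rule strict_mono_onI)
      fix x x' assume "x \<in> {b..1}" "x' \<in> {b..1}" "x < x'"
      then show "global_U x < global_U x'" using inv_z_diff(1)[of x x'] by (simp add: global_D_U_right)
    qed
    show "((\<lambda>x. global_q x / 2) has_integral global_U x / 4 - global_U b / 4) {b..x}" if "x \<in> {b..1}" for x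
      using weight_integrals_right(1)[of b x] that b_bounds
      by (simp add: global_D_U_right diff_divide_distrib)
  qed (use b_bounds in auto)
  then show ?thesis by (simp only: global_D_U_ends(4,6))
qed

text \<open>Up to \<open>1 - k\<close> the \<open>inv_y\<close> terms of the residual part and of
  the part sent down from \<open>[b, 1]\<close> cancel; above it \<open>inv_y\<close> is linear with
  slope 1.\<close>

lemma mass_total:
  "inv_y (max (-2) (min y (-1))) / 4 - db / 4 + (inv_y (max (-1) (min y (b + db))) / 4 - ds / 4)
    + ((max (-2) (min y (1 - k)) + k - inv_y (max (-2) (min y (1 - k)))) / 4 - (b - db) / 4)
    + (max (b + db) (min y 2) / 4 - (b + db) / 4) = (max (-2) (min y 2) + 2) / 4"
proof -
  have e: "1 - k < b + db" "b + db < 2" using eta_b_bounds by (auto simp: eta_b_def)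
  consider "y \<le> -2" | "-2 \<le> y" "y \<le> -1" | "-1 \<le> y" "y \<le> 1 - k" | "1 - k \<le> y" "y \<le> b + db" 
    | "b + db \<le> y" "y \<le> 2" | "2 \<le> y" by linarith
  then show ?thesis
    using e k1 k2 by cases (simp_all add: max_def min_def inv_y_values b_eq field_simps)
qed

lemma cdf_coupling:
  "(\<integral>\<^sup>+x. ennreal (1 - global_q x) * indicator {..y} (global_D x) + ennreal (global_q x) * indicator {..y} (global_U x) \<partial>uniform_on (-1) 1)
    = emeasure (uniform_on (-2) 2) {..y}"
proof -
  let ?f = "\<lambda>x. ennreal (1 - global_q x) * indicator {..y} (global_D x) + ennreal (global_q x) * indicator {..y} (global_U x)"
  let ?g = "\<lambda>x. ennreal ((1 - global_q x) / 2) * indicator {x\<in>{-1..b}. global_D x \<le> y} x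
      + ennreal (global_q x / 2) * indicator {x\<in>{-1..b}. global_U x \<le> y} x
      + ennreal ((1 - global_q x) / 2) * indicator {x\<in>{b..1}. global_D x \<le> y} x
      + ennreal (global_q x / 2) * indicator {x\<in>{b..1}. global_U x \<le> y} x"
  have half: "ennreal ((1 - global_q x) / 2) = ennreal (1 - global_q x) / 2" "ennreal (global_q x / 2) = ennreal (global_q x) / 2" for x
    using global_q_bounds[of x] divide_ennreal[of "1 - global_q x" 2] divide_ennreal[of "global_q x" 2] by auto
  \<comment> \<open>The point \<open>b\<close> lies in both intervals and would be counted
    twice.\<close>
  have "?f x * indicator {-1..1} x / 2 = ?g x" if "x \<noteq> b" for x
    using that b_bounds unfolding half
    by (auto simp: indicator_def add_divide_distrib_ennreal)
  then have ae: "AE x in lborel. ?f x * indicator {-1..1} x / 2 = ?g x"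
    using AE_lborel_singleton[of b] by (auto elim!: eventually_mono)
  have "(\<integral>\<^sup>+x. ?f x \<partial>uniform_on (-1) 1) = (\<integral>\<^sup>+x. ?f x * indicator {-1..1} x \<partial>lborel) / 2"
    unfolding uniform_on_def by (subst nn_integral_uniform_measure) auto
  also have "\<dots> = (\<integral>\<^sup>+x. ?f x * indicator {-1..1} x / 2 \<partial>lborel)"
    by (subst nn_integral_divide) auto
  also have "\<dots> = (\<integral>\<^sup>+x. ?g x \<partial>lborel)"
    by (rule nn_integral_cong_AE[OF ae])
  also have "\<dots> = ennreal (inv_y (max (-2) (min y (-1))) / 4 - db / 4)
      + ennreal (inv_y (max (-1) (min y (b + db))) / 4 - ds / 4)
      + ennreal ((max (-2) (min y (1 - k)) + k - inv_y (max (-2) (min y (1 - k)))) / 4 - (b - db) / 4)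
      + ennreal (max (b + db) (min y 2) / 4 - (b + db) / 4)"
    by (simp add: nn_integral_add mass_left_D mass_left_U mass_right_D mass_right_U del: atLeastAtMost_iff)
  also have "\<dots> = ennreal (inv_y (max (-2) (min y (-1))) / 4 - db / 4
      + (inv_y (max (-1) (min y (b + db))) / 4 - ds / 4)
      + ((max (-2) (min y (1 - k)) + k - inv_y (max (-2) (min y (1 - k)))) / 4 - (b - db) / 4)
      + (max (b + db) (min y 2) / 4 - (b + db) / 4))"
  proof -
    \<comment> \<open>\<open>ennreal\<close> truncates negative reals to 0, so the four terms may be
      added inside it only once each is known to be nonnegative.\<close>
    have "0 \<le> inv_y (max (-2) (min y (-1))) / 4 - db / 4"
      using inv_y_diff(1)[of "-2" "max (-2) (min y (-1))"] by (simp add: inv_y_values)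
    moreover have "0 \<le> inv_y (max (-1) (min y (b + db))) / 4 - ds / 4"
      using inv_y_diff(1)[of "-1" "max (-1) (min y (b + db))"] by (simp add: inv_y_values)
    moreover have "0 \<le> (max (-2) (min y (1 - k)) + k - inv_y (max (-2) (min y (1 - k)))) / 4 - (b - db) / 4"
      using inv_y_diff(2)[of "-2" "max (-2) (min y (1 - k))"] by (simp add: inv_y_values b_eq field_simps)
    moreover have "0 \<le> max (b + db) (min y 2) / 4 - (b + db) / 4"
      by (simp add: diff_divide_distrib[symmetric])
    ultimately show ?thesis by (simp add: ennreal_plus[symmetric] del: ennreal_plus)
  qed
  also have "\<dots> = ennreal ((max (-2) (min y 2) + 2) / 4)"
    by (simp only: mass_total)
  also have "\<dots> = emeasure (uniform_on (-2) 2) {..y}"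
  proof -
    have I: "{-2..2} \<inter> {..y} = {-2..min 2 y}" by auto
    have "emeasure lborel {-2..min 2 y} = ennreal (max (-2) (min y 2) + 2)"
      by (cases "-2 \<le> y") (auto simp: max_def min_def)
    moreover have "ennreal (max (-2) (min y 2) + 2) / 4 = ennreal ((max (-2) (min y 2) + 2) / 4)"
      using divide_ennreal[of "max (-2) (min y 2) + 2" 4] by auto
    ultimately show ?thesis
      unfolding uniform_on_def by (simp add: I)
  qed
  finally show ?thesis .
qed

text \<open>Almost everywhere the given maps and weight equal their Borel versions, to which the
  general criterion and the computed distribution function apply.\<close>

lemma glued_maps_coupling:
  assumes "glued_maps k D U"
  shows "two_point_coupling (uniform_on (-1) 1) D U (up_weight D U)
    \<in> barrier_couplings k (uniform_on (-1) 1) (uniform_on (-2) 2)"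
proof -
  have unif: "prob_space (uniform_on a c)" if "a < c" for a c
    unfolding uniform_on_def using that by (intro prob_space_uniform_measure) auto
  \<comment> \<open>The endpoint \<open>-1\<close>, where \<open>D = U\<close> and the weight is a
    convention, is a null set and is dropped.\<close>
  have ae: "AE x in uniform_on (-1) 1. P x" if "\<And>x. -1 < x \<Longrightarrow> x \<le> 1 \<Longrightarrow> P x" for P
    unfolding uniform_on_def 
  proof (rule AE_uniform_measureI)
    show "AE x in lborel. x \<in> {-1..1} \<longrightarrow> P x"
      using AE_lborel_singleton[of "-1::real"] by eventually_elim (auto intro: that)
  qed simp
  have eq: "D x = global_D x" "U x = global_U x" if "-1 < x" "x \<le> 1" for x
  proof -
    have "D x = global_D x \<and> U x = global_U x"
    proof (cases "x \<le> b")
      case True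
      then show ?thesis using glued_maps_eq[OF assms, of x] that by (simp add: global_D_U_left)
    next
      case False
      then have g: "inv_z x \<in> {db..1}" "zf k (inv_z x) = x" using zf_inv_z[of x] that by auto
      then have "D x = x - k \<and> U x = x + inv_z x"
        using assms unfolding glued_maps_def right_piece_def by metis
      then show ?thesis using False that by (simp add: global_D_U_right)
    qed
    then show "D x = global_D x" "U x = global_U x" by auto
  qed
  have "two_point_coupling (uniform_on (-1) 1) D U (up_weight D U)
      = two_point_coupling (uniform_on (-1) 1) global_D global_U global_q"
    by (intro two_point_coupling_cong_AE ae) (simp add: eq up_weight_def global_q_def)
  also have "\<dots> \<in> barrier_couplings k (uniform_on (-1) 1) (uniform_on (-2) 2)"
  proof (rule two_point_coupling_in_barrier_couplings)
    show "real_distribution (uniform_on (-2) 2)"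
      using unif[of "-2" 2] 
      by (auto simp: real_distribution_def real_distribution_axioms_def uniform_on_def)
  qed (auto intro!: ae unif simp: global_q_bounds global_q_mean global_D_U_barrier cdf_coupling uniform_on_def[of "-1" 1, THEN arg_cong[of _ _ sets]])
  finally show ?thesis .
qed

end

theorem proposition3p3:
  fixes k :: real
  assumes "1 < k" and "k < 2"
  shows "(\<forall>x\<in>{-1<..x0 k}. \<exists>!(L, R). LR_solution k x L R)
    \<and> LR_solution k (x0 k) (delta_0 k) 1
    \<and> (Lf k \<longlongrightarrow> delta_star k) (at_right (-1)) \<and> (Rf k \<longlongrightarrow> delta_star k) (at_right (-1))
    \<and> bij_betw (mid_source k) {delta_b k..delta_0 k} {x0 k..bpt k}
    \<and> bij_betw (zf k) {delta_b k..1} {bpt k..1}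
    \<and> (\<exists>D U. glued_maps k D U)
    \<and> (\<forall>D U. glued_maps k D U \<longrightarrow>
         two_point_coupling (uniform_on (-1) 1) D U (up_weight D U)
           \<in> barrier_couplings k (uniform_on (-1) 1) (uniform_on (-2) 2)
       \<and> monotone_construction k D U
       \<and> (\<forall>D' U'. monotone_construction k D' U' \<longrightarrow>
            (AE x in uniform_on (-1) 1. D' x = D x \<and> U' x = U x)))"
proof -
  interpret uniform_barrier k by standard (fact assms)+
  have "\<exists>!(L, R). LR_solution k x L R" if "x \<in> {-1<..x0 k}" for x
    using that by (intro ex1I[of _ "(low x, high x)"]) (auto simp: LR_iff_low_high)
  moreover have "LR_solution k (x0 k) (delta_0 k) 1"
    using ext_sol_x0 x0_bounds by (simp add: LR_iff_ext_sol)
  moreover have "AE x in uniform_on (-1) 1. D' x = D x \<and> U' x = U x"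
    if "glued_maps k D U" "monotone_construction k D' U'" for D U D' U'
    unfolding uniform_on_def
    using monotone_construction_unique[OF glued_maps_monotone[OF that(1)] that(2)]
    by (intro AE_uniform_measureI) auto
  ultimately show ?thesis
    using Lf_Rf_tendsto mid_source_bij zf_bij glued_maps_ex glued_maps_coupling glued_maps_monotone
    by (intro conjI ballI allI impI) simp_all
qed

end
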